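(* Let $n,m\in\mathbb{N}$, $p>1$, $E_0>E_D>0$, $\epsilon>0$, $\rho_{\min}\in(0,1)$, $V>0$, $D>0$, positive element volumes $v_1,\dots,v_n$ with $|\Omega|=\sum_e v_e$, and $E(\delta)=\left(\frac{1-\delta}{E_0}+\frac{\delta}{E_D}\right)^{-1}$. Let $\hat{\mathbf K}_1,\dots,\hat{\mathbf K}_n\in\mathbb{R}^{m\times m}$ be symmetric positive semidefinite and $\mathbf f\in\mathbb{R}^m$. For $\boldsymbol\rho\in\mathbb{R}^n$ let $\tilde\rho_e=\frac{\sum_{j\in V(e)}F_{ej}\rho_j}{\sum_{j\in V(e)}F_{ej}}$ (fixed nonempty index sets $V(e)$ and fixed positive weights $F_{ej}$), $\mathbf K_e(\boldsymbol\rho,\boldsymbol\delta)=\tilde\rho_e^{\,p}E(\delta_e)\hat{\mathbf K}_e$, $\mathbf K(\boldsymbol\rho,\boldsymbol\delta)=\sum_e\mathbf K_e(\boldsymbol\rho,\boldsymbol\delta)$, and assume $\mathbf K(\boldsymbol\rho,\boldsymbol\delta)$ is positive definite for all $\boldsymbol\rho\in U_{\mathrm{ad}}$, $\boldsymbol\delta\in[0,1]^n$, where $U_{\mathrm{ad}}=\{\boldsymbol\rho\in\mathbb{R}^n:\rho_{\min}\le\rho_e\le1,\ \sum_e v_e\rho_e/|\Omega|\le V\}$. Let $\Delta_{\mathrm{ad}}(\boldsymbol\rho)=\{\boldsymbol\delta\in\mathbb{R}^n:0\le\delta_e\le1,\ h(\boldsymbol\rho,\boldsymbol\delta)=0\}$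 with $h(\boldsymbol\rho,\boldsymbol\delta)=\sum_e v_e\tilde\rho_e^{\,p}\delta_e/|\Omega|-D$, and define $$F_\epsilon(\boldsymbol\rho)=\max_{\boldsymbol\delta\in\Delta_{\mathrm{ad}}(\boldsymbol\rho),\,\mathbf u\in\mathbb{R}^m}\mathcal J_\epsilon(\boldsymbol\rho,\boldsymbol\delta,\mathbf u),\qquad \mathcal J_\epsilon(\boldsymbol\rho,\boldsymbol\delta,\mathbf u)=2\mathbf f^\top\mathbf u-\sum_{e=1}^n\mathbf u^\top\mathbf K_e(\boldsymbol\rho,\boldsymbol\delta)\mathbf u-\frac{\epsilon}{2}\|\boldsymbol\delta\|^2.$$ Let $\bar{\boldsymbol\rho}\in U_{\mathrm{ad}}$, let $(\bar{\boldsymbol\delta},\bar{\mathbf u})$ denote the unique maximizer with $F_\epsilon(\bar{\boldsymbol\rho})=\mathcal J_\epsilon(\bar{\boldsymbol\rho},\bar{\boldsymbol\delta},\bar{\mathbf u})$, and assume the linear independence constraint qualification (LICQ) holds at $(\bar{\boldsymbol\delta},\bar{\mathbf u})$ for the inner maximization problem at $\bar{\boldsymbol\rho}$. Then $F_\epsilon$ is continuously differentiable at $\bar{\boldsymbol\rho}$ and $$\nabla F_\epsilon(\bar{\boldsymbol\rho})=\left[-\bar{\mathbf u}^\top\frac{\partial\mathbf K(\bar{\boldsymbol\rho},\bar{\boldsymbol\delta})}{\partial\rho_e}\bar{\mathbf u}\right]_{e=1}^n-\bar\lambda\,\nabla_{\boldsymbol\rho}h(\bar{\boldsymbol\rho},\bar{\boldsymbol\delta}),$$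 where $\bar\lambda$ is the (unique) Lagrange multiplier of the equality constraint $h=0$ at $(\bar{\boldsymbol\delta},\bar{\mathbf u})$.
   Context: The inner problem at $\bar{\boldsymbol\rho}$ is the maximization of $\mathcal J_\epsilon(\bar{\boldsymbol\rho},\cdot,\cdot)$ over $(\boldsymbol\delta,\mathbf u)$ subject to inequality constraints $g_e^-=-\delta_e\le0$, $g_e^+=\delta_e-1\le0$ ($e=1,\dots,n$) and equality constraint $h(\bar{\boldsymbol\rho},\boldsymbol\delta)=0$. LICQ at a feasible point means: the gradients with respect to $(\boldsymbol\delta,\mathbf u)$ of $h$ and of all active inequality constraints are linearly independent. The Lagrange multipliers $(\boldsymbol\lambda^-,\boldsymbol\lambda^+,\lambda)$ are those satisfying $\nabla_{(\boldsymbol\delta,\mathbf u)}\mathcal J_\epsilon-\sum_e(\lambda_e^-\nabla g_e^-+\lambda_e^+\nabla g_e^+)-\lambda\nabla_{(\boldsymbol\delta,\mathbf u)}h=0$, $\boldsymbol\lambda^\pm\ge0$, with complementarity; $\bar\lambda$ is the $h$-component. Here $\tilde\rho_e$ is the filtered pseudo-density, so $\partial\mathbf K/\partial\rho_e$ and $\nabla_{\boldsymbol\rho}h$ include the derivative of the filter. *)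

theory Defs
  imports "HOL-Analysis.Analysis"
begin

definition Emod :: "real \<Rightarrow> real \<Rightarrow> real \<Rightarrow> real" where
  "Emod E0 ED d = inverse ((1 - d) / E0 + d / ED)"

definition filt :: "('n \<Rightarrow> 'n set) \<Rightarrow> ('n \<Rightarrow> 'n \<Rightarrow> real) \<Rightarrow> real^'n \<Rightarrow> 'n \<Rightarrow> real" where
  "filt Vs Fw \<rho> e = (\<Sum>j\<in>Vs e. Fw e j * \<rho>$j) / (\<Sum>j\<in>Vs e. Fw e j)"

definition Kel :: "('n \<Rightarrow> 'n set) \<Rightarrow> ('n \<Rightarrow> 'n \<Rightarrow> real) \<Rightarrow> real \<Rightarrow> real \<Rightarrow> real
     \<Rightarrow> ('n::finite \<Rightarrow> real^'m^'m) \<Rightarrow> real^'n \<Rightarrow> real^'n \<Rightarrow> 'n \<Rightarrow> real^'m^'m" where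
  "Kel Vs Fw p E0 ED Khat \<rho> \<delta> e =
     ((filt Vs Fw \<rho> e) powr p * Emod E0 ED (\<delta>$e)) *\<^sub>R Khat e"

definition Kglob :: "('n \<Rightarrow> 'n set) \<Rightarrow> ('n \<Rightarrow> 'n \<Rightarrow> real) \<Rightarrow> real \<Rightarrow> real \<Rightarrow> real
     \<Rightarrow> ('n::finite \<Rightarrow> real^'m^'m) \<Rightarrow> real^'n \<Rightarrow> real^'n \<Rightarrow> real^'m^'m" where
  "Kglob Vs Fw p E0 ED Khat \<rho> \<delta> = (\<Sum>e\<in>UNIV. Kel Vs Fw p E0 ED Khat \<rho> \<delta> e)"

definition Jeps :: "('n \<Rightarrow> 'n set) \<Rightarrow> ('n \<Rightarrow> 'n \<Rightarrow> real) \<Rightarrow> real \<Rightarrow> real \<Rightarrow> real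
     \<Rightarrow> ('n::finite \<Rightarrow> real^'m^'m) \<Rightarrow> real^'m \<Rightarrow> real
     \<Rightarrow> real^'n \<Rightarrow> real^'n \<Rightarrow> real^'m \<Rightarrow> real" where
  "Jeps Vs Fw p E0 ED Khat f \<epsilon> \<rho> \<delta> u =
     2 * (f \<bullet> u) - (\<Sum>e\<in>UNIV. u \<bullet> (Kel Vs Fw p E0 ED Khat \<rho> \<delta> e *v u))
     - \<epsilon> / 2 * (norm \<delta>)\<^sup>2"

definition hcon :: "('n \<Rightarrow> 'n set) \<Rightarrow> ('n \<Rightarrow> 'n \<Rightarrow> real) \<Rightarrow> real \<Rightarrow> ('n::finite \<Rightarrow> real) \<Rightarrow> real
     \<Rightarrow> real^'n \<Rightarrow> real^'n \<Rightarrow> real" where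
  "hcon Vs Fw p vol D \<rho> \<delta> =
     (\<Sum>e\<in>UNIV. vol e * (filt Vs Fw \<rho> e) powr p * \<delta>$e) / (\<Sum>e\<in>UNIV. vol e) - D"

definition Uad :: "real \<Rightarrow> ('n::finite \<Rightarrow> real) \<Rightarrow> real \<Rightarrow> (real^'n) set" where
  "Uad rhomin vol Vf = {\<rho>. (\<forall>e. rhomin \<le> \<rho>$e \<and> \<rho>$e \<le> 1) \<and>
                           (\<Sum>e\<in>UNIV. vol e * \<rho>$e) / (\<Sum>e\<in>UNIV. vol e) \<le> Vf}"

definition Dad :: "('n \<Rightarrow> 'n set) \<Rightarrow> ('n \<Rightarrow> 'n \<Rightarrow> real) \<Rightarrow> real \<Rightarrow> ('n::finite \<Rightarrow> real) \<Rightarrow> real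
     \<Rightarrow> real^'n \<Rightarrow> (real^'n) set" where
  "Dad Vs Fw p vol D \<rho> = {\<delta>. (\<forall>e. 0 \<le> \<delta>$e \<and> \<delta>$e \<le> 1) \<and> hcon Vs Fw p vol D \<rho> \<delta> = 0}"

text \<open>F_eps(rho) = max over delta in Dad(rho), u in R^m of J_eps (written as Sup; it
  coincides with the max whenever the max is attained).\<close>
definition Feps :: "('n \<Rightarrow> 'n set) \<Rightarrow> ('n \<Rightarrow> 'n \<Rightarrow> real) \<Rightarrow> real \<Rightarrow> real \<Rightarrow> real
     \<Rightarrow> ('n::finite \<Rightarrow> real^'m^'m) \<Rightarrow> real^'m \<Rightarrow> real \<Rightarrow> ('n \<Rightarrow> real) \<Rightarrow> real
     \<Rightarrow> real^'n \<Rightarrow> real" where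
  "Feps Vs Fw p E0 ED Khat f \<epsilon> vol D \<rho> =
     Sup {Jeps Vs Fw p E0 ED Khat f \<epsilon> \<rho> \<delta> u | \<delta> u. \<delta> \<in> Dad Vs Fw p vol D \<rho>}"

definition sym_psd :: "real^'m^'m \<Rightarrow> bool" where
  "sym_psd A \<longleftrightarrow> transpose A = A \<and> (\<forall>x. 0 \<le> x \<bullet> (A *v x))"

definition pos_def :: "real^'m^'m \<Rightarrow> bool" where
  "pos_def A \<longleftrightarrow> transpose A = A \<and> (\<forall>x. x \<noteq> 0 \<longrightarrow> 0 < x \<bullet> (A *v x))"

definition gminus :: "'n::finite \<Rightarrow> (real^'n) \<times> (real^'m) \<Rightarrow> real" where
  "gminus e = (\<lambda>(d, u). - d$e)"

definition gplus :: "'n::finite \<Rightarrow> (real^'n) \<times> (real^'m) \<Rightarrow> real" where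
  "gplus e = (\<lambda>(d, u). d$e - 1)"

definition LICQ :: "((real^'n) \<times> (real^'m) \<Rightarrow> real) \<Rightarrow> (real^'n::finite) \<times> (real^'m) \<Rightarrow> bool" where
  "LICQ hf z \<longleftrightarrow>
     (\<forall>ch cm cp.
        (\<forall>w. ch * frechet_derivative hf (at z) w
             + (\<Sum>e\<in>{e. gminus e z = 0}. cm e * frechet_derivative (gminus e) (at z) w)
             + (\<Sum>e\<in>{e. gplus e z = 0}. cp e * frechet_derivative (gplus e) (at z) w) = 0)
        \<longrightarrow> ch = 0 \<and> (\<forall>e. gminus e z = 0 \<longrightarrow> cm e = 0) \<and> (\<forall>e. gplus e z = 0 \<longrightarrow> cp e = 0))"

text \<open>KKT conditions for maximizing Jf subject to gminus, gplus \<le> 0, hf = 0, with multipliers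
  (lm, lp, lam).\<close>
definition KKT :: "((real^'n) \<times> (real^'m) \<Rightarrow> real) \<Rightarrow> ((real^'n) \<times> (real^'m) \<Rightarrow> real)
     \<Rightarrow> (real^'n::finite) \<times> (real^'m) \<Rightarrow> ('n \<Rightarrow> real) \<Rightarrow> ('n \<Rightarrow> real) \<Rightarrow> real \<Rightarrow> bool" where
  "KKT Jf hf z lm lp lam \<longleftrightarrow>
     (\<forall>e. 0 \<le> lm e \<and> 0 \<le> lp e \<and> lm e * gminus e z = 0 \<and> lp e * gplus e z = 0) \<and>
     (\<forall>w. frechet_derivative Jf (at z) w
          - (\<Sum>e\<in>UNIV. lm e * frechet_derivative (gminus e) (at z) w
                       + lp e * frechet_derivative (gplus e) (at z) w)
          - lam * frechet_derivative hf (at z) w = 0)"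

end

theory Submission
  imports Defs
begin

text \<open>
  Every component of the gradient of \<open>h\<close> in \<open>\<delta>\<close> is positive, so LICQ says exactly that some
  component \<open>k\<close> of the maximizer satisfies \<open>0 < \<delta>\<^sub>k < 1\<close>. The constraint \<open>h = 0\<close> can then be
  solved for \<open>\<delta>\<^sub>k\<close>, which turns the inner problem near \<open>\<rho>\<close> into one whose feasible set does not
  vary locally. The objective is concave in \<open>(\<delta>, u)\<close>, because a quadratic form divided by an affine
  function is convex, and \<open>\<epsilon>\<close> makes it strictly concave; hence the maximizer is unique for all
  nearby \<open>\<rho>\<close>, and by compactness it depends continuously on \<open>\<rho>\<close>. An envelope argument gives the
  derivative of the value function, and stationarity in \<open>\<delta>\<^sub>k\<close> identifies the factor from the
  elimination with the multiplier.
\<close>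

text \<open>The obstacle is that the feasible set moves with \<rho>: a maximizer for one \<rho> is
  in general infeasible for another, so optimal values cannot be compared directly. Correcting the
  single slack component \<open>k\<close> repairs feasibility in both directions, and since
  \<open>h\<close> is affine in \<delta> the correction is an explicit quotient, with no implicit
  function theorem. Differentiability of the maximizer is never claimed, as the set of active bounds
  may change with \<rho>. The envelope argument asks only for its continuity and for the comparisons
  \<open>\<Phi> x (z x0) \<le> F x\<close> and \<open>\<Phi> x0 (z x) \<le> F x0\<close>. One fixed
  \<open>k\<close> serves on a whole neighborhood, so the gradient is a single expression there and
  its continuity is a limit computation.\<close>

section \<open>Envelope theorem, convergence by cluster points, convexity of the energy
  density\<close>

text \<open>The increment \<open>F x - F x0\<close> is squeezed between
  \<open>\<Phi> x c - \<Phi> x0 c\<close> for \<open>c = z x0\<close> and for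
  \<open>c = z x\<close>. The gradient is jointly continuous at \<open>(x0, z x0)\<close>, so both
  increments agree with the same linear map up to \<open>e * norm (x - x0)\<close>.\<close>

lemma envelope_has_derivative:
  fixes F :: "'a::real_inner \<Rightarrow> real" and z :: "'a \<Rightarrow> 'b::metric_space"
  assumes z: "(z \<longlongrightarrow> z x0) (nhds x0)"
    and g: "((\<lambda>y. g (fst y) (snd y)) \<longlongrightarrow> g x0 (z x0)) (nhds (x0, z x0))"
    and d\<Phi>: "\<forall>\<^sub>F y in nhds (x0, z x0).
               ((\<lambda>x. \<Phi> x (snd y)) has_derivative (\<lambda>v. g (fst y) (snd y) \<bullet> v)) (at (fst y))"
    and eq: "\<forall>\<^sub>F x in nhds x0. F x = \<Phi> x (z x)"
    and lower: "\<forall>\<^sub>F x in nhds x0. \<Phi> x (z x0) \<le> F x"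
    and upper: "\<forall>\<^sub>F x in nhds x0. \<Phi> x0 (z x) \<le> F x0"
  shows "(F has_derivative (\<lambda>v. g x0 (z x0) \<bullet> v)) (at x0)"
  unfolding has_derivative_at_alt
proof (intro conjI allI impI)
  show "bounded_linear ((\<bullet>) (g x0 (z x0)))" by (rule bounded_linear_inner_right)
  fix e :: real assume e: "0 < e"
  have "\<forall>\<^sub>F y in nhds (x0, z x0). dist (g (fst y) (snd y)) (g x0 (z x0)) < e"
    using g e by (rule tendstoD)
  with d\<Phi> have "\<forall>\<^sub>F y in nhds (x0, z x0).
      ((\<lambda>x. \<Phi> x (snd y)) has_derivative (\<lambda>v. g (fst y) (snd y) \<bullet> v)) (at (fst y)) \<and>
      dist (g (fst y) (snd y)) (g x0 (z x0)) < e"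
    by (rule eventually_conj)
  then obtain A B where AB: "eventually A (nhds x0)" "eventually B (nhds (z x0))"
    and near: "\<And>x c. A x \<Longrightarrow> B c \<Longrightarrow>
      ((\<lambda>x. \<Phi> x c) has_derivative (\<lambda>v. g x c \<bullet> v)) (at x) \<and> dist (g x c) (g x0 (z x0)) < e"
    unfolding nhds_prod eventually_prod_filter by auto
  have "\<forall>\<^sub>F x in nhds x0. B (z x)"
    using z AB(2) unfolding filterlim_iff by blast
  with AB(1) eq lower upper
  have "\<forall>\<^sub>F x in nhds x0. A x \<and> B (z x) \<and> F x = \<Phi> x (z x) \<and> \<Phi> x (z x0) \<le> F x \<and> \<Phi> x0 (z x) \<le> F x0"
    by eventually_elim auto
  then obtain d where d: "d > 0" and near_x: "\<And>x. dist x x0 < d \<Longrightarrow>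
      A x \<and> B (z x) \<and> F x = \<Phi> x (z x) \<and> \<Phi> x (z x0) \<le> F x \<and> \<Phi> x0 (z x) \<le> F x0"
    unfolding eventually_nhds_metric by metis
  have B0: "B (z x0)" and F0: "F x0 = \<Phi> x0 (z x0)"
    using near_x[of x0] d by auto
  \<comment> \<open>Mean value inequality for \<open>\<Phi>\<close> minus its expected linear part.
    The bound is uniform in \<open>c\<close>, which permits \<open>c = z x\<close> to vary together
    with \<open>x\<close>.\<close>
  have lin: "\<bar>\<Phi> x c - \<Phi> x0 c - g x0 (z x0) \<bullet> (x - x0)\<bar> \<le> e * norm (x - x0)"
    if x: "dist x x0 < d" and c: "B c" for x c
  proof -
    have "norm ((\<Phi> x c - g x0 (z x0) \<bullet> x) - (\<Phi> x0 c - g x0 (z x0) \<bullet> x0)) \<le> e * norm (x - x0)"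
    proof (rule differentiable_bound[where S = "ball x0 d" and f' = "\<lambda>y v. (g y c - g x0 (z x0)) \<bullet> v"])
      fix y assume y: "y \<in> ball x0 d"
      then have "A y" using near_x[of y] by (simp add: dist_commute)
      note ny = near[OF this c]
      show "((\<lambda>x. \<Phi> x c - g x0 (z x0) \<bullet> x) has_derivative (\<lambda>v. (g y c - g x0 (z x0)) \<bullet> v))
          (at y within ball x0 d)"
        by (rule has_derivative_at_withinI)
          (auto intro!: derivative_eq_intros conjunct1[OF ny] simp: inner_diff_left)
      show "onorm (\<lambda>v. (g y c - g x0 (z x0)) \<bullet> v) \<le> e"
      proof (rule onorm_bound)
        fix v
        have "norm ((g y c - g x0 (z x0)) \<bullet> v) \<le> norm (g y c - g x0 (z x0)) * norm v"
          using Cauchy_Schwarz_ineq2 by simp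
        also have "\<dots> \<le> e * norm v"
          using ny by (intro mult_right_mono) (auto simp: dist_norm)
        finally show "norm ((g y c - g x0 (z x0)) \<bullet> v) \<le> e * norm v" .
      qed (use e in simp)
    qed (use x d in \<open>auto simp: dist_commute\<close>)
    then show ?thesis by (simp add: inner_diff_right algebra_simps)
  qed
  show "\<exists>d>0. \<forall>y. norm (y - x0) < d \<longrightarrow>
          norm (F y - F x0 - g x0 (z x0) \<bullet> (y - x0)) \<le> e * norm (y - x0)"
  proof (intro exI[of _ d] conjI d allI impI)
    fix y assume "norm (y - x0) < d"
    then have y: "dist y x0 < d" by (simp add: dist_norm)
    show "norm (F y - F x0 - g x0 (z x0) \<bullet> (y - x0)) \<le> e * norm (y - x0)"
      using lin[OF y B0] lin[OF y, of "z y"] near_x[OF y] F0 by (auto simp: abs_le_iff)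
  qed
qed

text \<open>If convergence failed, some sequence tending to \<open>x0\<close> would keep its images
  away from \<open>z x0\<close>, yet compactness gives these images a cluster point, which has to be
  \<open>z x0\<close>.\<close>

lemma tendsto_nhds_if_unique_cluster:
  fixes z :: "'a::metric_space \<Rightarrow> 'b::metric_space"
  assumes K: "compact K" "\<forall>\<^sub>F x in nhds x0. z x \<in> K"
    and cluster: "\<And>X c. X \<longlonglongrightarrow> x0 \<Longrightarrow> (\<lambda>k. z (X k)) \<longlonglongrightarrow> c \<Longrightarrow> c \<in> K \<Longrightarrow> c = z x0"
  shows "(z \<longlongrightarrow> z x0) (nhds x0)"
proof (rule ccontr)
  assume "\<not> ?thesis"
  then obtain e where e: "e > 0" and "\<not> (\<forall>\<^sub>F x in nhds x0. dist (z x) (z x0) < e)"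
    unfolding tendsto_iff by auto
  obtain d where d: "d > 0" and dK: "\<And>x. dist x x0 < d \<Longrightarrow> z x \<in> K"
    using K(2) unfolding eventually_nhds_metric by auto
  have "\<exists>x. dist x x0 < min d (inverse (Suc k)) \<and> \<not> dist (z x) (z x0) < e" for k
    using \<open>\<not> (\<forall>\<^sub>F x in nhds x0. _ x)\<close> d unfolding eventually_nhds_metric
    by (metis min_less_iff_conj inverse_positive_iff_positive of_nat_0_less_iff zero_less_Suc)
  then obtain X where X: "\<And>k. dist (X k) x0 < min d (inverse (Suc k))"
    and far: "\<And>k. \<not> dist (z (X k)) (z x0) < e" by metis
  have "X \<longlonglongrightarrow> x0"
  proof (rule metric_tendsto_imp_tendsto[OF LIMSEQ_inverse_real_of_nat])
    show "\<forall>\<^sub>F k in sequentially. dist (X k) x0 \<le> dist (inverse (real (Suc k))) 0"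
      using X by (intro always_eventually allI) (simp add: less_imp_le)
  qed
  have "\<forall>k. z (X k) \<in> K" using X dK by simp
  then obtain c r where c: "c \<in> K" and r: "strict_mono (r :: nat \<Rightarrow> nat)"
    and lim: "((\<lambda>k. z (X k)) \<circ> r) \<longlonglongrightarrow> c"
    using K(1) unfolding compact_def by meson
  have "c = z x0"
  proof (rule cluster[OF _ _ c])
    show "(X \<circ> r) \<longlonglongrightarrow> x0" using \<open>X \<longlonglongrightarrow> x0\<close> r by (rule LIMSEQ_subseq_LIMSEQ)
    show "(\<lambda>k. z ((X \<circ> r) k)) \<longlonglongrightarrow> c" using lim by (simp add: o_def)
  qed
  with lim e have "\<forall>\<^sub>F k in sequentially. dist (z (X (r k))) (z x0) < e"
    unfolding tendsto_iff by (auto simp: o_def)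
  with far show False by (auto simp: eventually_sequentially)
qed

text \<open>The right side minus the left side is the form of \<open>A\<close> at
  \<open>l2 *\<^sub>R x - l1 *\<^sub>R y\<close>, divided by
  \<open>2 * l1 * l2 * (l1 + l2)\<close>.\<close>

lemma perspective_convex:
  fixes A :: "real^'m^'m"
  assumes A: "sym_psd A" and l: "0 < l1" "0 < l2"
  shows "((1/2) *\<^sub>R (x + y)) \<bullet> (A *v ((1/2) *\<^sub>R (x + y))) * inverse ((l1 + l2) / 2)
         \<le> (x \<bullet> (A *v x) * inverse l1 + y \<bullet> (A *v y) * inverse l2) / 2"
proof -
  have sym: "y \<bullet> (A *v x) = x \<bullet> (A *v y)"
    using A unfolding sym_psd_def by (metis dot_lmul_matrix inner_commute transpose_matrix_vector)
  have "0 \<le> (l2 *\<^sub>R x - l1 *\<^sub>R y) \<bullet> (A *v (l2 *\<^sub>R x - l1 *\<^sub>R y))"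
    using A by (simp add: sym_psd_def)
  also have "\<dots> = l2\<^sup>2 * (x \<bullet> (A *v x)) + l1\<^sup>2 * (y \<bullet> (A *v y)) - 2 * l1 * l2 * (x \<bullet> (A *v y))"
    by (simp add: matrix_vector_mult_diff_distrib matrix_vector_mult_scaleR inner_diff_left
        inner_diff_right sym power2_eq_square algebra_simps)
  finally have *: "2 * l1 * l2 * (x \<bullet> (A *v y)) \<le> l2\<^sup>2 * (x \<bullet> (A *v x)) + l1\<^sup>2 * (y \<bullet> (A *v y))"
    by simp
  have eq: "((1/2) *\<^sub>R (x + y)) \<bullet> (A *v ((1/2) *\<^sub>R (x + y)))
      = (x \<bullet> (A *v x) + y \<bullet> (A *v y) + 2 * (x \<bullet> (A *v y))) / 4"
    by (simp only: matrix_vector_mult_scaleR matrix_vector_right_distrib)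
      (simp add: inner_add_left inner_add_right sym add_divide_distrib algebra_simps)
  have "(a + b + 2 * c) / 4 * inverse ((l1 + l2) / 2) \<le> (a * inverse l1 + b * inverse l2) / 2"
    if "2 * l1 * l2 * c \<le> l2\<^sup>2 * a + l1\<^sup>2 * b" for a b c :: real
    using l that by (simp add: field_simps power2_eq_square)
  from this[OF *] show ?thesis unfolding eq .
qed

lemma bound_apply:
  "gminus e (d, u) = - d $ e" "gplus e (d, u) = d $ e - 1"
  by (simp_all add: gminus_def gplus_def)

lemma frechet_derivative_bounds:
  fixes z :: "(real^'n::finite) \<times> (real^'m::finite)"
  shows "frechet_derivative (gminus e) (at z) = (\<lambda>y. - fst y $ e)"
    and "frechet_derivative (gplus e) (at z) = (\<lambda>y. fst y $ e)"
proof -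
  have nth: "((\<lambda>z :: (real^'n) \<times> (real^'m). fst z $ e) has_derivative (\<lambda>y. fst y $ e)) (at z)"
    by (intro bounded_linear.has_derivative[OF bounded_linear_vec_nth] has_derivative_fst has_derivative_ident)
  show "frechet_derivative (gminus e) (at z) = (\<lambda>y. - fst y $ e)"
    unfolding gminus_def case_prod_beta
    by (rule frechet_derivative_at[symmetric]) (rule has_derivative_minus[OF nth])
  show "frechet_derivative (gplus e) (at z) = (\<lambda>y. fst y $ e)"
    unfolding gplus_def case_prod_beta
    by (rule frechet_derivative_at[symmetric])
      (use has_derivative_diff[OF nth has_derivative_const] in simp)
qed

subsection \<open>The inner problem\<close>

text \<open>\<open>a e \<rho>\<close> stands for \<open>\<rho>\<close>-tilde\<open>\<^sub>e\<close> to the power \<open>p\<close>, \<open>a' e\<close> for its gradient, and \<open>w e\<close> for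
  \<open>v\<^sub>e / |\<Omega>|\<close>. The open set \<open>P\<close> need not be contained in \<open>U\<^sub>a\<^sub>d\<close>: since all \<open>a e \<rho>\<close> are positive on
  \<open>P\<close>, definiteness of \<open>K\<close> there reduces to that of the sum of the \<open>Khat e\<close>.\<close>
locale parametric_compliance =
  fixes a :: "'n::finite \<Rightarrow> 'a::real_inner \<Rightarrow> real" and a' :: "'n \<Rightarrow> 'a \<Rightarrow> 'a" and P :: "'a set"
    and w :: "'n \<Rightarrow> real" and E0 ED \<epsilon> D :: real
    and Khat :: "'n \<Rightarrow> real^'m::finite^'m" and f :: "real^'m"
  assumes open_P: "open P"
    and a_pos: "\<rho> \<in> P \<Longrightarrow> 0 < a e \<rho>"
    and a_deriv: "\<rho> \<in> P \<Longrightarrow> (a e has_derivative (\<lambda>v. a' e \<rho> \<bullet> v)) (at \<rho>)"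
    and a'_cont: "continuous_on P (a' e)"
    and w_pos: "0 < w e"
    and E: "E0 > ED" "ED > 0"
    and eps: "\<epsilon> > 0"
    and Khat: "sym_psd (Khat e)"
    and Khat_sum: "u \<noteq> 0 \<Longrightarrow> 0 < (\<Sum>e\<in>UNIV. u \<bullet> (Khat e *v u))"
begin

abbreviation Em :: "real \<Rightarrow> real" where "Em \<equiv> Emod E0 ED"

abbreviation quad :: "'n \<Rightarrow> real^'m \<Rightarrow> real" where "quad e u \<equiv> u \<bullet> (Khat e *v u)"

text \<open>The reciprocal of \<open>Em\<close>. Being affine, it makes each energy term a quadratic
  form over an affine function. It is positive on a neighborhood of \<open>[0,1]\<close>, so limits
  and derivatives below assume \<open>0 < compl\<close> instead of the box bounds: corrected designs
  may leave the box.\<close>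

abbreviation compl :: "real \<Rightarrow> real" where "compl d \<equiv> (1 - d) / E0 + d / ED"

abbreviation kap :: real where "kap \<equiv> 1 / ED - 1 / E0"

definition J :: "'a \<Rightarrow> real^'n \<Rightarrow> real^'m \<Rightarrow> real" where
  "J \<rho> \<delta> u = 2 * (f \<bullet> u) - (\<Sum>e\<in>UNIV. a e \<rho> * Em (\<delta>$e) * quad e u) - \<epsilon> / 2 * (norm \<delta>)\<^sup>2"

text \<open>With the next two definitions, the partial gradients of \<open>J\<close>. The derivative
  of \<open>Em\<close> is \<open>- kap * Em\<^sup>2\<close>, hence the positive energy term in
  \<open>J_delta\<close>.\<close>

definition J_rho :: "'a \<Rightarrow> real^'n \<Rightarrow> real^'m \<Rightarrow> 'a" where
  "J_rho \<rho> \<delta> u = - (\<Sum>e\<in>UNIV. (Em (\<delta>$e) * quad e u) *\<^sub>R a' e \<rho>)"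

definition J_delta :: "'a \<Rightarrow> real^'n \<Rightarrow> real^'m \<Rightarrow> 'n \<Rightarrow> real" where
  "J_delta \<rho> \<delta> u e = a e \<rho> * kap * (Em (\<delta>$e))\<^sup>2 * quad e u - \<epsilon> * \<delta>$e"

definition J_u :: "'a \<Rightarrow> real^'n \<Rightarrow> real^'m \<Rightarrow> real^'m" where
  "J_u \<rho> \<delta> u = 2 *\<^sub>R (f - (\<Sum>e\<in>UNIV. (a e \<rho> * Em (\<delta>$e)) *\<^sub>R (Khat e *v u)))"

definition h :: "'a \<Rightarrow> real^'n \<Rightarrow> real" where
  "h \<rho> \<delta> = (\<Sum>e\<in>UNIV. w e * a e \<rho> * \<delta>$e) - D"

definition h_rho :: "'a \<Rightarrow> real^'n \<Rightarrow> 'a" where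
  "h_rho \<rho> \<delta> = (\<Sum>e\<in>UNIV. (w e * \<delta>$e) *\<^sub>R a' e \<rho>)"

definition feas :: "'a \<Rightarrow> (real^'n) set" where
  "feas \<rho> = {\<delta>. (\<forall>e. 0 \<le> \<delta>$e \<and> \<delta>$e \<le> 1) \<and> h \<rho> \<delta> = 0}"

definition is_max :: "'a \<Rightarrow> (real^'n) \<times> (real^'m) \<Rightarrow> bool" where
  "is_max \<rho> z \<longleftrightarrow> fst z \<in> feas \<rho> \<and> (\<forall>\<delta>\<in>feas \<rho>. \<forall>u. J \<rho> \<delta> u \<le> J \<rho> (fst z) (snd z))"

definition F :: "'a \<Rightarrow> real" where
  "F \<rho> = Sup {J \<rho> \<delta> u | \<delta> u. \<delta> \<in> feas \<rho>}"

lemma F_eq: "is_max \<rho> z \<Longrightarrow> F \<rho> = J \<rho> (fst z) (snd z)"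
  unfolding F_def is_max_def by (rule cSup_eq_maximum) auto

lemma kap_pos: "0 < kap"
  using E by (simp add: field_simps)

lemma compl_eq: "compl d = 1 / E0 + d * kap"
  using E by (simp add: field_simps)

lemma compl_pos: "0 \<le> d \<Longrightarrow> 0 < compl d"
  unfolding compl_eq using E kap_pos by (intro add_pos_nonneg mult_nonneg_nonneg) auto

lemma Em_pos: "0 \<le> d \<Longrightarrow> 0 < Em d"
  unfolding Emod_def using compl_pos by simp

lemma Em_ge: assumes "0 \<le> d" "d \<le> 1" shows "ED \<le> Em d"
proof -
  have "compl d \<le> 1 / E0 + kap"
    unfolding compl_eq using assms kap_pos by (intro add_left_mono) (simp add: mult_left_le_one_le)
  then have "inverse (1 / ED) \<le> inverse (compl d)"
    using compl_pos[OF assms(1)] by (intro le_imp_inverse_le) auto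
  then show ?thesis by (simp add: Emod_def)
qed

lemma quad_nonneg: "0 \<le> quad e u"
  using Khat[of e] by (simp add: sym_psd_def)

lemma Khat_sym: "x \<bullet> (Khat e *v y) = y \<bullet> (Khat e *v x)"
  using Khat[of e] unfolding sym_psd_def
  by (metis dot_lmul_matrix inner_commute transpose_matrix_vector)

section \<open>Continuity and derivatives of the objective and the constraint\<close>

lemma tendsto_a [tendsto_intros]:
  assumes "(r \<longlongrightarrow> \<rho>) G" "\<rho> \<in> P" shows "((\<lambda>x. a e (r x)) \<longlongrightarrow> a e \<rho>) G"
  using has_derivative_continuous[OF a_deriv[OF assms(2)]] assms(1) by (rule isCont_tendsto_compose)

lemma tendsto_a' [tendsto_intros]:
  assumes "(r \<longlongrightarrow> \<rho>) G" "\<rho> \<in> P" shows "((\<lambda>x. a' e (r x)) \<longlongrightarrow> a' e \<rho>) G"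
proof -
  have "isCont (a' e) \<rho>"
    using a'_cont[of e] open_P assms(2) by (simp add: continuous_on_eq_continuous_at)
  then show ?thesis using assms(1) by (rule isCont_tendsto_compose)
qed

lemma tendsto_Em [tendsto_intros]:
  assumes "(g \<longlongrightarrow> d) G" "0 < compl d" shows "((\<lambda>x. Em (g x)) \<longlongrightarrow> Em d) G"
  unfolding Emod_def using assms E by (intro tendsto_intros) auto

lemma tendsto_quad [tendsto_intros]:
  assumes "(v \<longlongrightarrow> u) G" shows "((\<lambda>x. quad e (v x)) \<longlongrightarrow> quad e u) G"
  by (intro tendsto_intros assms bounded_linear.tendsto[OF matrix_vector_mul_bounded_linear])

lemma tendsto_J [tendsto_intros]:
  assumes "(r \<longlongrightarrow> \<rho>) G" "\<rho> \<in> P" "(d \<longlongrightarrow> \<delta>) G" "\<And>e. 0 < compl (\<delta>$e)" "(v \<longlongrightarrow> u) G"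
  shows "((\<lambda>x. J (r x) (d x) (v x)) \<longlongrightarrow> J \<rho> \<delta> u) G"
  unfolding J_def by (intro tendsto_intros assms)

lemma tendsto_J_rho [tendsto_intros]:
  assumes "(r \<longlongrightarrow> \<rho>) G" "\<rho> \<in> P" "(d \<longlongrightarrow> \<delta>) G" "\<And>e. 0 < compl (\<delta>$e)" "(v \<longlongrightarrow> u) G"
  shows "((\<lambda>x. J_rho (r x) (d x) (v x)) \<longlongrightarrow> J_rho \<rho> \<delta> u) G"
  unfolding J_rho_def by (intro tendsto_intros assms)

lemma tendsto_J_delta [tendsto_intros]:
  assumes "(r \<longlongrightarrow> \<rho>) G" "\<rho> \<in> P" "(d \<longlongrightarrow> \<delta>) G" "\<And>e. 0 < compl (\<delta>$e)" "(v \<longlongrightarrow> u) G"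
  shows "((\<lambda>x. J_delta (r x) (d x) (v x) e) \<longlongrightarrow> J_delta \<rho> \<delta> u e) G"
  unfolding J_delta_def by (intro tendsto_intros assms)

lemma tendsto_h [tendsto_intros]:
  assumes "(r \<longlongrightarrow> \<rho>) G" "\<rho> \<in> P" "(d \<longlongrightarrow> \<delta>) G"
  shows "((\<lambda>x. h (r x) (d x)) \<longlongrightarrow> h \<rho> \<delta>) G"
  unfolding h_def by (intro tendsto_intros assms)

lemma tendsto_h_rho [tendsto_intros]:
  assumes "(r \<longlongrightarrow> \<rho>) G" "\<rho> \<in> P" "(d \<longlongrightarrow> \<delta>) G"
  shows "((\<lambda>x. h_rho (r x) (d x)) \<longlongrightarrow> h_rho \<rho> \<delta>) G"
  unfolding h_rho_def by (intro tendsto_intros assms)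

lemma has_derivative_a:
  assumes "(r has_derivative r') (at x within S)" "r x \<in> P"
  shows "((\<lambda>x. a e (r x)) has_derivative (\<lambda>y. a' e (r x) \<bullet> r' y)) (at x within S)"
  using has_derivative_compose[OF assms(1) a_deriv[OF assms(2)]] .

lemma has_derivative_Em:
  assumes "(g has_derivative g') (at x within S)" "0 < compl (g x)"
  shows "((\<lambda>x. Em (g x)) has_derivative (\<lambda>y. - (kap * (Em (g x))\<^sup>2 * g' y))) (at x within S)"
proof -
  have c: "((\<lambda>x. compl (g x)) has_derivative (\<lambda>y. kap * g' y)) (at x within S)"
    unfolding compl_eq by (auto intro!: derivative_eq_intros assms(1))
  show ?thesis unfolding Emod_def
    by (rule has_derivative_eq_rhs[OF Deriv.has_derivative_inverse[OF _ c]])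
      (use assms(2) in \<open>auto simp: power2_eq_square\<close>)
qed

lemma has_derivative_quad:
  assumes "(v has_derivative v') (at x within S)"
  shows "((\<lambda>x. quad e (v x)) has_derivative (\<lambda>y. 2 * ((Khat e *v v x) \<bullet> v' y))) (at x within S)"
proof -
  have c: "((\<lambda>x. Khat e *v v x) has_derivative (\<lambda>y. Khat e *v v' y)) (at x within S)"
    using assms by (rule bounded_linear.has_derivative[OF matrix_vector_mul_bounded_linear])
  show ?thesis
    by (rule has_derivative_eq_rhs[OF has_derivative_inner[OF assms c]])
      (simp add: fun_eq_iff Khat_sym[of "v x"] inner_commute)
qed

lemma has_derivative_nth:
  assumes "(d has_derivative d') (at x within S)"
  shows "((\<lambda>x. d x $ e) has_derivative (\<lambda>y. d' y $ e)) (at x within S)"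
  using assms by (rule bounded_linear.has_derivative[OF bounded_linear_vec_nth])

text \<open>Stated as a chain rule along arbitrary maps \<open>r\<close>, \<open>d\<close>,
  \<open>v\<close>, so that it covers the dependence on \<rho> through the eliminated component, the
  feasible directions and the joint derivative in \<open>(\<delta>, u)\<close>.\<close>

lemma has_derivative_J:
  assumes r: "(r has_derivative r') (at x within S)" "r x \<in> P"
    and d: "(d has_derivative d') (at x within S)" "\<And>e. 0 < compl (d x $ e)"
    and v: "(v has_derivative v') (at x within S)"
  shows "((\<lambda>x. J (r x) (d x) (v x)) has_derivative
     (\<lambda>y. J_rho (r x) (d x) (v x) \<bullet> r' y + (\<Sum>e\<in>UNIV. J_delta (r x) (d x) (v x) e * d' y $ e)
          + J_u (r x) (d x) (v x) \<bullet> v' y)) (at x within S)"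
proof -
  note D = has_derivative_a[OF r] has_derivative_Em[OF has_derivative_nth[OF d(1)] d(2)]
    has_derivative_quad[OF v]
  have sq: "((\<lambda>x. (norm (d x))\<^sup>2) has_derivative (\<lambda>y. 2 * (d x \<bullet> d' y))) (at x within S)"
    unfolding power2_norm_eq_inner
    by (rule has_derivative_eq_rhs[OF has_derivative_inner[OF d(1) d(1)]])
      (simp add: inner_commute)
  have lin: "((\<lambda>x. 2 * (f \<bullet> v x)) has_derivative (\<lambda>y. 2 * (f \<bullet> v' y))) (at x within S)"
    by (intro has_derivative_mult_right has_derivative_inner_right v)
  have energy: "((\<lambda>x. a e (r x) * Em (d x $ e) * quad e (v x)) has_derivative
      (\<lambda>y. (Em (d x $ e) * quad e (v x)) * (a' e (r x) \<bullet> r' y)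
        - a e (r x) * kap * (Em (d x $ e))\<^sup>2 * quad e (v x) * d' y $ e
        + 2 * ((a e (r x) * Em (d x $ e)) * ((Khat e *v v x) \<bullet> v' y)))) (at x within S)" for e
    by (rule has_derivative_eq_rhs[OF has_derivative_mult[OF has_derivative_mult[OF D(1,2)] D(3)]])
      (simp add: fun_eq_iff algebra_simps)
  have "((\<lambda>x. J (r x) (d x) (v x)) has_derivative
     (\<lambda>y. 2 * (f \<bullet> v' y) - (\<Sum>e\<in>UNIV. (Em (d x $ e) * quad e (v x)) * (a' e (r x) \<bullet> r' y)
        - a e (r x) * kap * (Em (d x $ e))\<^sup>2 * quad e (v x) * d' y $ e
        + 2 * ((a e (r x) * Em (d x $ e)) * ((Khat e *v v x) \<bullet> v' y)))
        - \<epsilon> / 2 * (2 * (d x \<bullet> d' y)))) (at x within S)"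
    unfolding J_def
    by (intro has_derivative_diff lin has_derivative_sum energy has_derivative_mult_right sq)
  then show ?thesis
  proof (rule has_derivative_eq_rhs, intro ext)
    fix y
    have "J_rho (r x) (d x) (v x) \<bullet> r' y = - (\<Sum>e\<in>UNIV. (Em (d x $ e) * quad e (v x)) * (a' e (r x) \<bullet> r' y))"
      by (simp add: J_rho_def inner_sum_left)
    moreover have "(\<Sum>e\<in>UNIV. J_delta (r x) (d x) (v x) e * d' y $ e) =
        (\<Sum>e\<in>UNIV. a e (r x) * kap * (Em (d x $ e))\<^sup>2 * quad e (v x) * d' y $ e) - \<epsilon> * (d x \<bullet> d' y)"
      by (simp add: J_delta_def inner_vec_def left_diff_distrib sum_subtractf sum_distrib_left mult.assoc)
    moreover have "J_u (r x) (d x) (v x) \<bullet> v' y =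
        2 * (f \<bullet> v' y) - (\<Sum>e\<in>UNIV. 2 * ((a e (r x) * Em (d x $ e)) * ((Khat e *v v x) \<bullet> v' y)))"
      by (simp add: J_u_def inner_diff_left inner_sum_left right_diff_distrib sum_distrib_left mult.assoc)
    ultimately show "2 * (f \<bullet> v' y) - (\<Sum>e\<in>UNIV. (Em (d x $ e) * quad e (v x)) * (a' e (r x) \<bullet> r' y)
        - a e (r x) * kap * (Em (d x $ e))\<^sup>2 * quad e (v x) * d' y $ e
        + 2 * ((a e (r x) * Em (d x $ e)) * ((Khat e *v v x) \<bullet> v' y)))
        - \<epsilon> / 2 * (2 * (d x \<bullet> d' y)) =
      J_rho (r x) (d x) (v x) \<bullet> r' y + (\<Sum>e\<in>UNIV. J_delta (r x) (d x) (v x) e * d' y $ e)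
        + J_u (r x) (d x) (v x) \<bullet> v' y"
      by (simp only: sum.distrib sum_subtractf)
  qed
qed

lemma has_derivative_h:
  assumes r: "(r has_derivative r') (at x within S)" "r x \<in> P"
    and d: "(d has_derivative d') (at x within S)"
  shows "((\<lambda>x. h (r x) (d x)) has_derivative
     (\<lambda>y. h_rho (r x) (d x) \<bullet> r' y + (\<Sum>e\<in>UNIV. w e * a e (r x) * d' y $ e))) (at x within S)"
proof -
  have "((\<lambda>x. h (r x) (d x)) has_derivative
     (\<lambda>y. (\<Sum>e\<in>UNIV. w e * a e (r x) * d' y $ e + w e * (a' e (r x) \<bullet> r' y) * d x $ e) - 0))
     (at x within S)"
    unfolding h_def
    by (intro has_derivative_diff has_derivative_const has_derivative_sum has_derivative_mult
        has_derivative_mult_right has_derivative_a[OF r] has_derivative_nth[OF d])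
  then show ?thesis
    by (rule has_derivative_eq_rhs)
      (simp add: fun_eq_iff h_rho_def inner_sum_left sum.distrib algebra_simps)
qed

subsection \<open>Existence and uniqueness of the maximizer\<close>

lemma energy_pos:
  assumes "\<rho> \<in> P" "\<And>e. 0 \<le> \<delta>$e" "u \<noteq> 0"
  shows "0 < (\<Sum>e\<in>UNIV. a e \<rho> * Em (\<delta>$e) * quad e u)"
proof -
  have c: "0 < a e \<rho> * Em (\<delta>$e)" for e
    using a_pos[OF assms(1)] Em_pos[OF assms(2)] by simp
  obtain e where "0 < quad e u"
    using Khat_sum[OF assms(3)] sum_nonpos[of UNIV "\<lambda>e. quad e u"] by (meson UNIV_I linorder_not_le)
  then show ?thesis
    by (intro sum_pos2[where i = e]) (auto intro!: mult_pos_pos mult_nonneg_nonneg c less_imp_le[OF c] quad_nonneg)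
qed

text \<open>The energy is midpoint convex by \<open>perspective_convex\<close>, the load term is
  linear, and the parallelogram identity for the regularization yields the gain
  \<open>\<epsilon> / 8\<close>. Midpoints suffice for uniqueness.\<close>

lemma J_midpoint:
  assumes \<rho>: "\<rho> \<in> P" and \<delta>: "\<And>e. 0 \<le> \<delta>$e" and \<eta>: "\<And>e. 0 \<le> \<eta>$e"
  shows "(J \<rho> \<delta> u + J \<rho> \<eta> v) / 2 + \<epsilon> / 8 * (norm (\<delta> - \<eta>))\<^sup>2
         \<le> J \<rho> ((1/2) *\<^sub>R (\<delta> + \<eta>)) ((1/2) *\<^sub>R (u + v))"
proof -
  let ?d = "(1/2) *\<^sub>R (\<delta> + \<eta>)" and ?u = "(1/2) *\<^sub>R (u + v)"
  have "a e \<rho> * Em (?d$e) * quad e ?u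
      \<le> (a e \<rho> * Em (\<delta>$e) * quad e u + a e \<rho> * Em (\<eta>$e) * quad e v) / 2" for e
  proof -
    have mid: "compl (?d $ e) = (compl (\<delta>$e) + compl (\<eta>$e)) / 2"
      unfolding compl_eq by (simp add: field_simps)
    have "quad e ?u * Em (?d$e) \<le> (quad e u * Em (\<delta>$e) + quad e v * Em (\<eta>$e)) / 2"
      unfolding Emod_def mid
      by (rule perspective_convex[OF Khat compl_pos[OF \<delta>] compl_pos[OF \<eta>]])
    then have "a e \<rho> * (quad e ?u * Em (?d$e)) \<le> a e \<rho> * ((quad e u * Em (\<delta>$e) + quad e v * Em (\<eta>$e)) / 2)"
      using a_pos[OF \<rho>] by (intro mult_left_mono) (auto simp: less_imp_le)
    then show ?thesis by (simp add: algebra_simps)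
  qed
  then have "(\<Sum>e\<in>UNIV. a e \<rho> * Em (?d$e) * quad e ?u)
      \<le> (\<Sum>e\<in>UNIV. (a e \<rho> * Em (\<delta>$e) * quad e u + a e \<rho> * Em (\<eta>$e) * quad e v) / 2)"
    by (intro sum_mono)
  also have "\<dots> = ((\<Sum>e\<in>UNIV. a e \<rho> * Em (\<delta>$e) * quad e u)
      + (\<Sum>e\<in>UNIV. a e \<rho> * Em (\<eta>$e) * quad e v)) / 2"
    by (simp only: sum_divide_distrib[symmetric] sum.distrib)
  finally have energy: "(\<Sum>e\<in>UNIV. a e \<rho> * Em (?d$e) * quad e ?u) \<le> \<dots>" .
  have "(norm ?d)\<^sup>2 = ((norm \<delta>)\<^sup>2 + (norm \<eta>)\<^sup>2) / 2 - (norm (\<delta> - \<eta>))\<^sup>2 / 4"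
    by (simp add: power2_norm_eq_inner inner_add_left inner_add_right inner_diff_left
        inner_diff_right inner_commute field_simps)
  then have "\<epsilon> / 2 * (norm ?d)\<^sup>2 = (\<epsilon> / 2 * (norm \<delta>)\<^sup>2 + \<epsilon> / 2 * (norm \<eta>)\<^sup>2) / 2 - \<epsilon> / 8 * (norm (\<delta> - \<eta>))\<^sup>2"
    by (simp only:) (simp add: right_diff_distrib distrib_left add_divide_distrib)
  moreover have "2 * (f \<bullet> ?u) = (2 * (f \<bullet> u) + 2 * (f \<bullet> v)) / 2"
    by (simp add: inner_add_right)
  ultimately show ?thesis
    using energy unfolding J_def by argo
qed

text \<open>For fixed \<delta> the objective is quadratic in \<open>u\<close>, so the midpoint gain
  is exact. It supplies the strictness in \<open>u\<close>, on which the gain in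
  \<open>J_midpoint\<close> does not depend.\<close>

lemma J_midpoint_u:
  "J \<rho> \<delta> ((1/2) *\<^sub>R (u + v)) = (J \<rho> \<delta> u + J \<rho> \<delta> v) / 2
     + (\<Sum>e\<in>UNIV. a e \<rho> * Em (\<delta>$e) * quad e (u - v)) / 4"
proof -
  have "quad e ((1/2) *\<^sub>R (u + v)) = (quad e u + quad e v) / 2 - quad e (u - v) / 4" for e
    by (simp add: matrix_vector_mult_scaleR matrix_vector_right_distrib
        matrix_vector_mult_diff_distrib inner_add_left inner_add_right inner_diff_left
        inner_diff_right Khat_sym[of v e u] field_simps)
  then have "(\<Sum>e\<in>UNIV. a e \<rho> * Em (\<delta>$e) * quad e ((1/2) *\<^sub>R (u + v))) =
      (\<Sum>e\<in>UNIV. (a e \<rho> * Em (\<delta>$e) * quad e u + a e \<rho> * Em (\<delta>$e) * quad e v) / 2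
        - a e \<rho> * Em (\<delta>$e) * quad e (u - v) / 4)"
    by (intro sum.cong refl) (simp only: right_diff_distrib distrib_left times_divide_eq_right)
  also have "\<dots> = ((\<Sum>e\<in>UNIV. a e \<rho> * Em (\<delta>$e) * quad e u) + (\<Sum>e\<in>UNIV. a e \<rho> * Em (\<delta>$e) * quad e v)) / 2
        - (\<Sum>e\<in>UNIV. a e \<rho> * Em (\<delta>$e) * quad e (u - v)) / 4"
    by (simp only: sum_subtractf sum_divide_distrib[symmetric] sum.distrib)
  finally have energy: "(\<Sum>e\<in>UNIV. a e \<rho> * Em (\<delta>$e) * quad e ((1/2) *\<^sub>R (u + v))) = \<dots>" .
  have "2 * (f \<bullet> ((1/2) *\<^sub>R (u + v))) = (2 * (f \<bullet> u) + 2 * (f \<bullet> v)) / 2"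
    by (simp add: inner_add_right)
  with energy show ?thesis unfolding J_def by argo
qed

lemma feas_midpoint:
  assumes "\<delta> \<in> feas \<rho>" "\<eta> \<in> feas \<rho>" shows "(1/2) *\<^sub>R (\<delta> + \<eta>) \<in> feas \<rho>"
proof -
  have "(\<Sum>e\<in>UNIV. w e * a e \<rho> * ((1/2) *\<^sub>R (\<delta> + \<eta>))$e)
      = (\<Sum>e\<in>UNIV. (w e * a e \<rho> * \<delta>$e + w e * a e \<rho> * \<eta>$e) / 2)"
    by (simp add: algebra_simps add_divide_distrib)
  also have "\<dots> = ((\<Sum>e\<in>UNIV. w e * a e \<rho> * \<delta>$e) + (\<Sum>e\<in>UNIV. w e * a e \<rho> * \<eta>$e)) / 2"
    by (simp only: sum_divide_distrib[symmetric] sum.distrib)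
  finally have "h \<rho> ((1/2) *\<^sub>R (\<delta> + \<eta>)) = (h \<rho> \<delta> + h \<rho> \<eta>) / 2"
    by (simp add: h_def)
  then show ?thesis using assms by (auto simp: feas_def add_nonneg_nonneg) (smt (verit))
qed

text \<open>The midpoint of two maximizers is feasible and cannot do better, so both gains vanish:
  the \<epsilon>-term forces equal \<delta>, and definiteness of the energy then forces equal
  \<open>u\<close>.\<close>

lemma is_max_unique:
  assumes \<rho>: "\<rho> \<in> P" and z: "is_max \<rho> z" and z': "is_max \<rho> z'"
  shows "z = z'"
proof -
  obtain \<delta> u \<eta> v where zz: "z = (\<delta>, u)" "z' = (\<eta>, v)" by fastforce
  have feas: "\<delta> \<in> feas \<rho>" "\<eta> \<in> feas \<rho>" and eq: "J \<rho> \<delta> u = J \<rho> \<eta> v"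
    and max: "\<And>d x. d \<in> feas \<rho> \<Longrightarrow> J \<rho> d x \<le> J \<rho> \<delta> u"
    using z z' unfolding is_max_def zz by (auto intro: antisym)
  have nonneg: "0 \<le> \<delta>$e" "0 \<le> \<eta>$e" for e using feas by (auto simp: feas_def)
  have "\<epsilon> / 8 * (norm (\<delta> - \<eta>))\<^sup>2 \<le> 0"
    using J_midpoint[OF \<rho> nonneg, of u v] max[OF feas_midpoint[OF feas], of "(1/2) *\<^sub>R (u + v)"] eq
    by simp
  then have "\<delta> = \<eta>" using eps by (simp add: mult_le_0_iff)
  moreover have "u = v"
  proof (rule ccontr)
    assume "u \<noteq> v"
    then have "0 < (\<Sum>e\<in>UNIV. a e \<rho> * Em (\<delta>$e) * quad e (u - v))"
      by (intro energy_pos[OF \<rho> nonneg(1)]) simp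
    then show False
      using J_midpoint_u[of \<rho> \<delta> u v] max[OF feas(1), of "(1/2) *\<^sub>R (u + v)"] eq \<open>\<delta> = \<eta>\<close> by simp
  qed
  ultimately show ?thesis by (simp add: zz)
qed

text \<open>The constant is the minimum of the form on the unit sphere; homogeneity of degree two
  extends the bound to all \<open>u\<close>.\<close>

lemma coercive:
  obtains \<kappa> where "0 < \<kappa>" "\<And>u. \<kappa> * (norm u)\<^sup>2 \<le> (\<Sum>e\<in>UNIV. quad e u)"
proof -
  define Q where "Q u = (\<Sum>e\<in>UNIV. quad e u)" for u
  have "continuous_on (sphere 0 1) Q"
    unfolding Q_def continuous_on_def by (intro ballI tendsto_intros)
  moreover have "sphere (0 :: real^'m) 1 \<noteq> {}" by simp
  ultimately obtain x where x: "norm x = 1" and min: "\<And>y. norm y = 1 \<Longrightarrow> Q x \<le> Q y"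
    using continuous_attains_inf[OF compact_sphere] by (metis dist_0_norm mem_sphere)
  have scale: "Q (c *\<^sub>R u) = c\<^sup>2 * Q u" for c u
    unfolding Q_def by (simp add: matrix_vector_mult_scaleR sum_distrib_left power2_eq_square mult.assoc)
  show thesis
  proof (rule that)
    show "0 < Q x" unfolding Q_def using x by (intro Khat_sum) auto
    fix u
    show "Q x * (norm u)\<^sup>2 \<le> (\<Sum>e\<in>UNIV. quad e u)"
    proof (cases "u = 0")
      case False
      then have "Q x * (norm u)\<^sup>2 \<le> Q ((1 / norm u) *\<^sub>R u) * (norm u)\<^sup>2"
        by (intro mult_right_mono min) auto
      also have "\<dots> = Q u" using False by (simp add: scale power_divide)
      finally show ?thesis by (simp add: Q_def)
    qed simp
  qed
qed

text \<open>A \<open>u\<close> at least as good as zero has energy at most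
  \<open>2 * (f \<bullet> u)\<close>, which is linear, while coercivity makes the energy quadratic.
  The radius depends on \<rho> only through \<open>c\<close>, so one ball serves all nearby
  \<rho>.\<close>

lemma norm_bound:
  assumes c: "0 < c"
  obtains R where "\<And>\<rho> \<delta> u. (\<And>e. c \<le> a e \<rho>) \<Longrightarrow> (\<And>e. 0 \<le> \<delta>$e \<and> \<delta>$e \<le> 1) \<Longrightarrow>
    J \<rho> \<delta> 0 \<le> J \<rho> \<delta> u \<Longrightarrow> norm u \<le> R"
proof -
  obtain \<kappa> where \<kappa>: "0 < \<kappa>" "\<And>u. \<kappa> * (norm u)\<^sup>2 \<le> (\<Sum>e\<in>UNIV. quad e u)"
    by (rule coercive) blast
  show thesis
  proof (rule that[of "2 * norm f / (c * ED * \<kappa>)"])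
    fix \<rho> \<delta> u
    assume ac: "\<And>e. c \<le> a e \<rho>" and \<delta>: "\<And>e. 0 \<le> \<delta>$e \<and> \<delta>$e \<le> 1"
      and J: "J \<rho> \<delta> 0 \<le> J \<rho> \<delta> u"
    have "c * ED * (\<kappa> * (norm u)\<^sup>2) \<le> c * ED * (\<Sum>e\<in>UNIV. quad e u)"
      using c E \<kappa>(2) by (intro mult_left_mono) auto
    also have "\<dots> = (\<Sum>e\<in>UNIV. c * ED * quad e u)" by (rule sum_distrib_left)
    also have "\<dots> \<le> (\<Sum>e\<in>UNIV. a e \<rho> * Em (\<delta>$e) * quad e u)"
      using ac \<delta> c E Em_ge order_trans[OF less_imp_le[OF c] ac]
      by (intro sum_mono mult_right_mono mult_mono quad_nonneg) auto
    also have "\<dots> \<le> 2 * (f \<bullet> u)" using J by (simp add: J_def)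
    also have "\<dots> \<le> 2 * (norm f * norm u)" using norm_cauchy_schwarz by simp
    finally have "(c * ED * \<kappa> * norm u) * norm u \<le> (2 * norm f) * norm u"
      by (simp add: power2_eq_square mult_ac)
    then have "u = 0 \<or> c * ED * \<kappa> * norm u \<le> 2 * norm f"
      by (auto simp: mult_le_cancel_right)
    moreover have "0 < c * ED * \<kappa>" using c E \<kappa> by simp
    ultimately show "norm u \<le> 2 * norm f / (c * ED * \<kappa>)"
      by (auto simp: pos_le_divide_eq mult.commute)
  qed
qed

lemma compact_unit_cube: "compact {\<delta> :: real^'n. \<forall>e. 0 \<le> \<delta>$e \<and> \<delta>$e \<le> 1}"
proof -
  have "{\<delta> :: real^'n. \<forall>e. 0 \<le> \<delta>$e \<and> \<delta>$e \<le> 1} = cbox 0 1"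
    by (auto simp: mem_box_cart)
  then show ?thesis by simp
qed

lemma compact_feas: assumes "\<rho> \<in> P" shows "compact (feas \<rho>)"
proof -
  have "continuous_on UNIV (h \<rho>)"
    unfolding continuous_on_def using assms by (intro ballI tendsto_intros)
  then have "closed {\<delta>. h \<rho> \<delta> = 0}"
    by (intro closed_Collect_eq continuous_on_const)
  moreover have "feas \<rho> = {\<delta>. \<forall>e. 0 \<le> \<delta>$e \<and> \<delta>$e \<le> 1} \<inter> {\<delta>. h \<rho> \<delta> = 0}"
    by (auto simp: feas_def)
  ultimately show ?thesis using compact_unit_cube by (simp add: compact_Int_closed)
qed

text \<open>The set of pairs \<open>(\<delta>, u)\<close> is unbounded in \<open>u\<close>. The
  maximum is taken over a compact ball, and any \<open>u\<close> outside it is beaten by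
  \<open>u = 0\<close> with the same \<delta>.\<close>

lemma is_max_exists:
  assumes \<rho>: "\<rho> \<in> P" and ne: "feas \<rho> \<noteq> {}"
  shows "\<exists>z. is_max \<rho> z"
proof -
  have "0 < Min (range (\<lambda>e. a e \<rho>))" using a_pos[OF \<rho>] by simp
  then obtain R where R: "\<And>\<rho>' \<delta> u. (\<And>e. Min (range (\<lambda>e. a e \<rho>)) \<le> a e \<rho>') \<Longrightarrow>
      (\<And>e. 0 \<le> \<delta>$e \<and> \<delta>$e \<le> 1) \<Longrightarrow> J \<rho>' \<delta> 0 \<le> J \<rho>' \<delta> u \<Longrightarrow> norm u \<le> R"
    by (rule norm_bound) blast
  have bound: "norm u \<le> R" if "\<delta> \<in> feas \<rho>" "J \<rho> \<delta> 0 \<le> J \<rho> \<delta> u" for \<delta> u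
    using that by (intro R[of \<rho> \<delta> u]) (auto simp: feas_def)
  have R0: "0 \<le> R" using bound[of _ 0] ne by auto
  let ?K = "feas \<rho> \<times> cball (0 :: real^'m) R"
  have cont: "continuous_on ?K (\<lambda>z. J \<rho> (fst z) (snd z))"
    unfolding continuous_on_def
    using \<rho> by (intro ballI tendsto_intros compl_pos) (auto simp: feas_def)
  have comp: "compact ?K" using compact_feas[OF \<rho>] by (intro compact_Times) auto
  have "?K \<noteq> {}" using ne R0 by auto
  then obtain z where z: "z \<in> ?K"
    and max: "\<And>y. y \<in> ?K \<Longrightarrow> J \<rho> (fst y) (snd y) \<le> J \<rho> (fst z) (snd z)"
    using continuous_attains_sup[OF comp _ cont] by blast
  have "J \<rho> \<delta> u \<le> J \<rho> (fst z) (snd z)" if \<delta>: "\<delta> \<in> feas \<rho>" for \<delta> u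
  proof (cases "norm u \<le> R")
    case True then show ?thesis using max[of "(\<delta>, u)"] \<delta> by simp
  next
    case False
    then have "J \<rho> \<delta> u \<le> J \<rho> \<delta> 0" using bound[OF \<delta>, of u] by linarith
    also have "\<dots> \<le> J \<rho> (fst z) (snd z)" using max[of "(\<delta>, 0)"] \<delta> R0 by simp
    finally show ?thesis .
  qed
  with z show ?thesis unfolding is_max_def by (intro exI[of _ z]) auto
qed

subsection \<open>Elimination of an inactive component\<close>

definition sol :: "'a \<Rightarrow> (real^'n) \<times> (real^'m)" where
  "sol \<rho> = (SOME z. is_max \<rho> z)"

lemma is_max_sol: "\<rho> \<in> P \<Longrightarrow> feas \<rho> \<noteq> {} \<Longrightarrow> is_max \<rho> (sol \<rho>)"
  unfolding sol_def using is_max_exists by (rule someI_ex)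

lemma sol_eq: "\<rho> \<in> P \<Longrightarrow> is_max \<rho> z \<Longrightarrow> sol \<rho> = z"
  using is_max_sol is_max_unique unfolding is_max_def by (metis empty_iff)

text \<open>Changes component \<open>k\<close> so that the constraint \<open>h = 0\<close> holds at \<open>\<rho>\<close>; feasible points stay fixed.\<close>
definition shift :: "'n \<Rightarrow> 'a \<Rightarrow> real^'n \<Rightarrow> real^'n" where
  "shift k \<rho> \<delta> = \<delta> - (h \<rho> \<delta> / (w k * a k \<rho>)) *\<^sub>R axis k 1"

lemma shift_nth: "shift k \<rho> \<delta> $ e = (if e = k then \<delta>$k - h \<rho> \<delta> / (w k * a k \<rho>) else \<delta>$e)"
  by (simp add: shift_def axis_def)

lemma h_shift: assumes "\<rho> \<in> P" shows "h \<rho> (shift k \<rho> \<delta>) = 0"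
proof -
  have "w e * a e \<rho> * shift k \<rho> \<delta> $ e = w e * a e \<rho> * \<delta>$e - (if e = k then h \<rho> \<delta> else 0)" for e
    using w_pos[of k] a_pos[OF assms, of k] by (simp add: shift_nth field_simps)
  then have "h \<rho> (shift k \<rho> \<delta>) = h \<rho> \<delta> - (\<Sum>e\<in>UNIV. if e = k then h \<rho> \<delta> else 0)"
    unfolding h_def[of _ "shift k \<rho> \<delta>"] by (simp add: sum_subtractf h_def[of \<rho> \<delta>])
  then show ?thesis by simp
qed

lemma shift_feas: "\<delta> \<in> feas \<rho> \<Longrightarrow> shift k \<rho> \<delta> = \<delta>"
  by (simp add: shift_def feas_def)

lemma shift_in_feas:
  assumes "\<rho> \<in> P" "\<And>e. 0 \<le> \<delta>$e \<and> \<delta>$e \<le> 1" "0 < shift k \<rho> \<delta> $ k" "shift k \<rho> \<delta> $ k < 1"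
  shows "shift k \<rho> \<delta> \<in> feas \<rho>"
  using assms h_shift[OF assms(1)] by (auto simp: feas_def shift_nth)

lemma tendsto_shift [tendsto_intros]:
  assumes "(r \<longlongrightarrow> \<rho>) G" "\<rho> \<in> P" "(d \<longlongrightarrow> \<delta>) G"
  shows "((\<lambda>x. shift k (r x) (d x)) \<longlongrightarrow> shift k \<rho> \<delta>) G"
  unfolding shift_def using w_pos[of k] a_pos[OF assms(2), of k]
  by (intro tendsto_intros assms) auto

definition J_red :: "'n \<Rightarrow> 'a \<Rightarrow> (real^'n) \<times> (real^'m) \<Rightarrow> real" where
  "J_red k \<rho> z = J \<rho> (shift k \<rho> (fst z)) (snd z)"

text \<open>The last factor, divided by \<open>w k * a k \<rho>\<close>, is the gradient of the
  quotient in \<open>shift\<close>. At feasible points \<open>h\<close> vanishes and this is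
  \<open>J_rho\<close> minus a multiple of \<open>h_rho\<close>. The term with \<open>a' k\<close>
  matters at pairs where the \<delta> is not feasible for the \<rho>, as occur in every
  neighborhood.\<close>

definition grad_red :: "'n \<Rightarrow> 'a \<Rightarrow> (real^'n) \<times> (real^'m) \<Rightarrow> 'a" where
  "grad_red k \<rho> z = (let \<delta> = shift k \<rho> (fst z) in
     J_rho \<rho> \<delta> (snd z) - (J_delta \<rho> \<delta> (snd z) k / (w k * a k \<rho>)) *\<^sub>R
       (h_rho \<rho> (fst z) - (h \<rho> (fst z) / a k \<rho>) *\<^sub>R a' k \<rho>))"

lemma has_derivative_J_red:
  assumes \<rho>: "\<rho> \<in> P" and c: "\<And>e. 0 < compl (shift k \<rho> (fst z) $ e)"
  shows "((\<lambda>\<rho>. J_red k \<rho> z) has_derivative (\<lambda>v. grad_red k \<rho> z \<bullet> v)) (at \<rho>)"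
proof -
  obtain \<delta> u where z: "z = (\<delta>, u)" by fastforce
  have pos: "0 < w k" "0 < a k \<rho>" using w_pos a_pos[OF \<rho>] by auto
  have hd: "((\<lambda>\<rho>. h \<rho> \<delta>) has_derivative (\<lambda>v. h_rho \<rho> \<delta> \<bullet> v)) (at \<rho>)"
    by (rule has_derivative_eq_rhs[OF has_derivative_h[OF has_derivative_ident \<rho> has_derivative_const]]) simp
  have sd: "((\<lambda>\<rho>. shift k \<rho> \<delta>) has_derivative
      (\<lambda>v. (- ((h_rho \<rho> \<delta> - (h \<rho> \<delta> / a k \<rho>) *\<^sub>R a' k \<rho>) \<bullet> v) / (w k * a k \<rho>)) *\<^sub>R axis k 1)) (at \<rho>)"
  proof -
    \<comment> \<open>The quotient rule with one factor \<open>w k * a k \<rho>\<close>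
      cancelled.\<close>
    have quot: "(A * (b * c) - H * (b * B)) / (b * c * (b * c)) = (A - H / c * B) / (b * c)"
      if "0 < b" "0 < c" for A B H b c :: real
      using that by (simp add: field_simps)
    have "((\<lambda>\<rho>. h \<rho> \<delta> / (w k * a k \<rho>)) has_derivative
        (\<lambda>v. (h_rho \<rho> \<delta> - (h \<rho> \<delta> / a k \<rho>) *\<^sub>R a' k \<rho>) \<bullet> v / (w k * a k \<rho>))) (at \<rho>)"
      by (rule has_derivative_eq_rhs[OF has_derivative_divide'[OF hd
            has_derivative_mult_right[OF a_deriv[OF \<rho>]]]])
        (use pos in \<open>auto simp: quot inner_diff_left\<close>)
    then have "((\<lambda>\<rho>. \<delta> - (h \<rho> \<delta> / (w k * a k \<rho>)) *\<^sub>R axis k 1) has_derivative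
        (\<lambda>v. 0 - ((h_rho \<rho> \<delta> - (h \<rho> \<delta> / a k \<rho>) *\<^sub>R a' k \<rho>) \<bullet> v / (w k * a k \<rho>)) *\<^sub>R axis k 1)) (at \<rho>)"
      by (intro has_derivative_diff has_derivative_const has_derivative_scaleR_left)
    then show ?thesis unfolding shift_def by (rule has_derivative_eq_rhs) simp
  qed
  have "((\<lambda>\<rho>. J \<rho> (shift k \<rho> \<delta>) u) has_derivative (\<lambda>v. J_rho \<rho> (shift k \<rho> \<delta>) u \<bullet> v +
      (\<Sum>e\<in>UNIV. J_delta \<rho> (shift k \<rho> \<delta>) u e *
        ((- ((h_rho \<rho> \<delta> - (h \<rho> \<delta> / a k \<rho>) *\<^sub>R a' k \<rho>) \<bullet> v) / (w k * a k \<rho>)) *\<^sub>R axis k 1) $ e)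
      + J_u \<rho> (shift k \<rho> \<delta>) u \<bullet> 0)) (at \<rho>)"
    using c by (intro has_derivative_J[OF has_derivative_ident \<rho> sd _ has_derivative_const]) (simp add: z)
  then show ?thesis unfolding J_red_def z fst_conv snd_conv
  proof (rule has_derivative_eq_rhs, intro ext)
    fix v
    have pick: "(\<Sum>e\<in>UNIV. g e * (c *\<^sub>R axis k 1) $ e) = g k * c" for g :: "'n \<Rightarrow> real" and c :: real
      by (simp add: axis_def if_distrib[of "\<lambda>x. _ * x"] cong: if_cong)
    show "J_rho \<rho> (shift k \<rho> \<delta>) u \<bullet> v +
      (\<Sum>e\<in>UNIV. J_delta \<rho> (shift k \<rho> \<delta>) u e *
        ((- ((h_rho \<rho> \<delta> - (h \<rho> \<delta> / a k \<rho>) *\<^sub>R a' k \<rho>) \<bullet> v) / (w k * a k \<rho>)) *\<^sub>R axis k 1) $ e)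
      + J_u \<rho> (shift k \<rho> \<delta>) u \<bullet> 0 = grad_red k \<rho> (\<delta>, u) \<bullet> v"
      unfolding pick grad_red_def Let_def fst_conv snd_conv inner_diff_left[of "J_rho _ _ _"]
        inner_scaleR_left
      by simp
  qed
qed

lemma tendsto_grad_red [tendsto_intros]:
  assumes "(r \<longlongrightarrow> \<rho>) G" "\<rho> \<in> P" "(y \<longlongrightarrow> z) G" "\<And>e. 0 < compl (shift k \<rho> (fst z) $ e)"
  shows "((\<lambda>x. grad_red k (r x) (y x)) \<longlongrightarrow> grad_red k \<rho> z) G"
  unfolding grad_red_def Let_def using w_pos[of k] a_pos[OF assms(2), of k]
  by (intro tendsto_intros assms) auto

section \<open>Continuity of the maximizer and derivative of the value function\<close>

text \<open>The parameters for which the same \<open>k\<close> can be eliminated. Nonempty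
  \<open>feas\<close> ensures that \<open>sol\<close> is a maximizer and not an arbitrary
  choice.\<close>

definition interior_sol :: "'n \<Rightarrow> 'a set" where
  "interior_sol k = {\<rho> \<in> P. feas \<rho> \<noteq> {} \<and> 0 < fst (sol \<rho>) $ k \<and> fst (sol \<rho>) $ k < 1}"

lemma eventually_in_P: "\<rho> \<in> P \<Longrightarrow> \<forall>\<^sub>F x in nhds \<rho>. x \<in> P"
  using open_P by (auto intro: eventually_nhds_in_open)

text \<open>The correction is continuous and fixes the feasible \<delta>, so component
  \<open>k\<close> stays strictly inside its bounds. Both arguments may vary since the lemma is used
  both ways: the maximizer at \<rho> is moved to nearby parameters, and nearby maximizers are moved
  to \<rho>.\<close>

lemma eventually_shift_in_feas:
  assumes r: "(r \<longlongrightarrow> \<rho>) G" "\<rho> \<in> P" and d: "(d \<longlongrightarrow> \<delta>) G"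
    and cube: "\<forall>\<^sub>F x in G. \<forall>e. 0 \<le> d x $ e \<and> d x $ e \<le> 1"
    and \<delta>: "\<delta> \<in> feas \<rho>" "0 < \<delta>$k" "\<delta>$k < 1"
  shows "\<forall>\<^sub>F x in G. shift k (r x) (d x) \<in> feas (r x)"
proof -
  have "\<forall>\<^sub>F x in G. r x \<in> P" using r open_P topological_tendstoD by blast
  moreover have "((\<lambda>x. shift k (r x) (d x) $ k) \<longlongrightarrow> \<delta>$k) G"
    using tendsto_vec_nth[OF tendsto_shift[OF r d, of k], of k] shift_feas[OF \<delta>(1)] by simp
  then have "\<forall>\<^sub>F x in G. 0 < shift k (r x) (d x) $ k" "\<forall>\<^sub>F x in G. shift k (r x) (d x) $ k < 1"
    using \<delta> by (auto dest: order_tendstoD)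
  ultimately show ?thesis using cube
    by eventually_elim (auto intro: shift_in_feas)
qed

lemma interior_solD:
  assumes "\<rho> \<in> interior_sol k"
  shows "\<rho> \<in> P" "is_max \<rho> (sol \<rho>)" "fst (sol \<rho>) \<in> feas \<rho>" "0 < fst (sol \<rho>) $ k" "fst (sol \<rho>) $ k < 1"
    "\<And>e. 0 \<le> fst (sol \<rho>) $ e \<and> fst (sol \<rho>) $ e \<le> 1"
  using assms is_max_sol[of \<rho>] by (auto simp: interior_sol_def is_max_def feas_def)

lemma eventually_feas:
  assumes "\<rho> \<in> interior_sol k"
  shows "\<forall>\<^sub>F x in nhds \<rho>. shift k x (fst (sol \<rho>)) \<in> feas x"
  using interior_solD[OF assms]
  by (intro eventually_shift_in_feas[where \<rho> = \<rho> and \<delta> = "fst (sol \<rho>)"]) (auto intro: filterlim_ident)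

text \<open>Every cluster point of nearby maximizers is again a maximizer at \<rho>: feasibility
  passes to the limit, and so does the comparison with the corrected maximizer of \<rho>. Uniqueness
  then identifies it.\<close>

lemma tendsto_sol:
  assumes "\<rho> \<in> interior_sol k"
  shows "(sol \<longlongrightarrow> sol \<rho>) (nhds \<rho>)"
proof -
  note \<rho> = interior_solD[OF assms]
  have ev_max: "\<forall>\<^sub>F x in nhds \<rho>. is_max x (sol x)"
    using eventually_in_P[OF \<rho>(1)] eventually_feas[OF assms]
    by eventually_elim (auto intro: is_max_sol)
  define m where "m = Min (range (\<lambda>e. a e \<rho>))"
  \<comment> \<open>Half the minimum leaves room, so that the strict bound \<open>c < a e x\<close>
    persists for \<open>x\<close> near \<rho>.\<close>
  define c where "c = m / 2"
  have "0 < m" "\<And>e. m \<le> a e \<rho>" unfolding m_def using a_pos[OF \<rho>(1)] by auto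
  then have c: "0 < c" "\<And>e. c < a e \<rho>"
    unfolding c_def by (simp, smt (verit) field_sum_of_halves)
  obtain R where R: "\<And>\<rho> \<delta> u. (\<And>e. c \<le> a e \<rho>) \<Longrightarrow> (\<And>e. 0 \<le> \<delta>$e \<and> \<delta>$e \<le> 1) \<Longrightarrow>
    J \<rho> \<delta> 0 \<le> J \<rho> \<delta> u \<Longrightarrow> norm u \<le> R"
    using c(1) by (rule norm_bound) blast
  define K where "K = {\<delta> :: real^'n. \<forall>e. 0 \<le> \<delta>$e \<and> \<delta>$e \<le> 1} \<times> cball (0 :: real^'m) R"
  have "\<forall>\<^sub>F x in nhds \<rho>. c < a e x" for e
    using tendsto_a[OF filterlim_ident \<rho>(1), of e] c(2)[of e] by (rule order_tendstoD)
  then have "\<forall>\<^sub>F x in nhds \<rho>. \<forall>e. c < a e x" by (simp add: eventually_all_finite)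
  with ev_max have inK: "\<forall>\<^sub>F x in nhds \<rho>. sol x \<in> K"
    by eventually_elim
      (auto simp: K_def is_max_def mem_Times_iff feas_def less_imp_le intro!: R)
  show ?thesis
  proof (rule tendsto_nhds_if_unique_cluster[OF _ inK])
    show "compact K" unfolding K_def by (intro compact_Times compact_unit_cube compact_cball)
    fix X z assume X: "X \<longlonglongrightarrow> \<rho>" and lim: "(\<lambda>i. sol (X i)) \<longlonglongrightarrow> z" and "z \<in> K"
    then have cube: "0 \<le> fst z $ e" "fst z $ e \<le> 1" for e by (auto simp: K_def mem_Times_iff)
    have ev_X: "\<forall>\<^sub>F i in sequentially. Q (X i)" if "\<forall>\<^sub>F x in nhds \<rho>. Q x" for Q
      using X that by (auto simp: filterlim_iff)
    have ev: "\<forall>\<^sub>F i in sequentially. h (X i) (fst (sol (X i))) = 0 \<and>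
        J (X i) (shift k (X i) (fst (sol \<rho>))) (snd (sol \<rho>)) \<le> J (X i) (fst (sol (X i))) (snd (sol (X i)))"
      using ev_X[OF ev_max] ev_X[OF eventually_feas[OF assms]]
      by eventually_elim (auto simp: is_max_def feas_def)
    have "(\<lambda>i. h (X i) (fst (sol (X i)))) \<longlonglongrightarrow> h \<rho> (fst z)"
      by (intro tendsto_intros X lim \<rho>)
    moreover have "(\<lambda>i. h (X i) (fst (sol (X i)))) \<longlonglongrightarrow> 0"
      by (rule tendsto_eventually) (use ev in \<open>auto elim: eventually_mono\<close>)
    ultimately have "h \<rho> (fst z) = 0" by (rule LIMSEQ_unique)
    then have feas_z: "fst z \<in> feas \<rho>" using cube by (simp add: feas_def)
    have "J \<rho> (shift k \<rho> (fst (sol \<rho>))) (snd (sol \<rho>)) \<le> J \<rho> (fst z) (snd z)"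
    proof (rule tendsto_le[OF sequentially_bot])
      show "(\<lambda>i. J (X i) (fst (sol (X i))) (snd (sol (X i)))) \<longlonglongrightarrow> J \<rho> (fst z) (snd z)"
        by (intro tendsto_intros X lim \<rho> compl_pos cube)
      show "(\<lambda>i. J (X i) (shift k (X i) (fst (sol \<rho>))) (snd (sol \<rho>)))
          \<longlonglongrightarrow> J \<rho> (shift k \<rho> (fst (sol \<rho>))) (snd (sol \<rho>))"
        using \<rho> by (intro tendsto_intros X compl_pos) (auto simp: shift_feas)
    qed (use ev in \<open>auto elim: eventually_mono\<close>)
    then have "is_max \<rho> z"
      using feas_z \<rho>(2) by (auto simp: is_max_def shift_feas[OF \<rho>(3)] intro: order_trans)
    then show "z = sol \<rho>" using sol_eq[OF \<rho>(1)] by simp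
  qed
qed

text \<open>Continuity of \<open>sol\<close> preserves both strict bounds on component
  \<open>k\<close>, and the corrected maximizer shows that nearby feasible sets are
  nonempty.\<close>

lemma open_interior_sol: "open (interior_sol k)"
proof -
  have "\<forall>\<^sub>F x in nhds \<rho>. x \<in> interior_sol k" if "\<rho> \<in> interior_sol k" for \<rho>
  proof -
    note \<rho> = interior_solD[OF that]
    have "((\<lambda>x. fst (sol x) $ k) \<longlongrightarrow> fst (sol \<rho>) $ k) (nhds \<rho>)"
      by (intro tendsto_intros tendsto_sol[OF that])
    then have "\<forall>\<^sub>F x in nhds \<rho>. 0 < fst (sol x) $ k" "\<forall>\<^sub>F x in nhds \<rho>. fst (sol x) $ k < 1"
      using \<rho> by (auto dest: order_tendstoD)
    with eventually_in_P[OF \<rho>(1)] eventually_feas[OF that] show ?thesis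
      by eventually_elim (auto simp: interior_sol_def)
  qed
  then show ?thesis
    unfolding eventually_nhds subset_eq[symmetric] by (simp add: open_subopen[of "interior_sol k"])
qed

lemma F_has_derivative:
  assumes "\<rho> \<in> interior_sol k"
  shows "(F has_derivative (\<lambda>v. grad_red k \<rho> (sol \<rho>) \<bullet> v)) (at \<rho>)"
proof (rule envelope_has_derivative[where \<Phi> = "J_red k"])
  note \<rho> = interior_solD[OF assms]
  have compl_\<rho>: "0 < compl (shift k \<rho> (fst (sol \<rho>)) $ e)" for e
    using \<rho> by (auto simp: shift_feas intro: compl_pos)
  show lim: "(sol \<longlongrightarrow> sol \<rho>) (nhds \<rho>)" by (rule tendsto_sol[OF assms])
  have fs: "(fst \<longlongrightarrow> \<rho>) (nhds (\<rho>, sol \<rho>))" "(snd \<longlongrightarrow> sol \<rho>) (nhds (\<rho>, sol \<rho>))"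
    using tendsto_fst[OF filterlim_ident, of "(\<rho>, sol \<rho>)"] tendsto_snd[OF filterlim_ident, of "(\<rho>, sol \<rho>)"]
    by auto
  show "((\<lambda>y. grad_red k (fst y) (snd y)) \<longlongrightarrow> grad_red k \<rho> (sol \<rho>)) (nhds (\<rho>, sol \<rho>))"
    by (intro tendsto_intros fs \<rho> compl_\<rho>)
  show "\<forall>\<^sub>F y in nhds (\<rho>, sol \<rho>). ((\<lambda>x. J_red k x (snd y)) has_derivative
      (\<lambda>v. grad_red k (fst y) (snd y) \<bullet> v)) (at (fst y))"
  proof -
    have "\<forall>\<^sub>F y in nhds (\<rho>, sol \<rho>). 0 < compl (shift k (fst y) (fst (snd y)) $ e)" for e
    proof (rule order_tendstoD(1)[OF _ compl_\<rho>])
      show "((\<lambda>y. compl (shift k (fst y) (fst (snd y)) $ e))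
          \<longlongrightarrow> compl (shift k \<rho> (fst (sol \<rho>)) $ e)) (nhds (\<rho>, sol \<rho>))"
        using E by (intro tendsto_intros fs \<rho>) auto
    qed
    then have "\<forall>\<^sub>F y in nhds (\<rho>, sol \<rho>). \<forall>e. 0 < compl (shift k (fst y) (fst (snd y)) $ e)"
      by (simp add: eventually_all_finite)
    moreover have "\<forall>\<^sub>F y in nhds (\<rho>, sol \<rho>). fst y \<in> P"
      using fs(1) open_P \<rho>(1) topological_tendstoD by blast
    ultimately show ?thesis by eventually_elim (auto intro: has_derivative_J_red)
  qed
  have near: "\<forall>\<^sub>F x in nhds \<rho>. x \<in> interior_sol k"
    using open_interior_sol assms by (rule eventually_nhds_in_open)
  show "\<forall>\<^sub>F x in nhds \<rho>. F x = J_red k x (sol x)"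
    using near
    by eventually_elim (use interior_solD in \<open>simp add: J_red_def shift_feas F_eq\<close>)
  \<comment> \<open>The maximizer of \<rho>, corrected for \<open>x\<close>, is an admissible
    competitor at \<open>x\<close>.\<close>
  show "\<forall>\<^sub>F x in nhds \<rho>. J_red k x (sol \<rho>) \<le> F x"
    using near eventually_feas[OF assms]
  proof eventually_elim
    case (elim x)
    then show ?case using interior_solD(2)[of x k] F_eq[of x "sol x"]
      by (auto simp: J_red_def is_max_def)
  qed
  \<comment> \<open>The opposite comparison: maximizers of nearby \<open>x\<close>, corrected for
    \<rho>, compete at \<rho>. Continuity of \<open>sol\<close> enters here.\<close>
  have "\<forall>\<^sub>F x in nhds \<rho>. shift k \<rho> (fst (sol x)) \<in> feas \<rho>"
  proof (rule eventually_shift_in_feas[where r = "\<lambda>_. \<rho>"])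
    show "((\<lambda>x. fst (sol x)) \<longlongrightarrow> fst (sol \<rho>)) (nhds \<rho>)" by (intro tendsto_intros lim)
    show "\<forall>\<^sub>F x in nhds \<rho>. \<forall>e. 0 \<le> fst (sol x) $ e \<and> fst (sol x) $ e \<le> 1"
      using near by eventually_elim (use interior_solD in blast)
  qed (use \<rho> in auto)
  then show "\<forall>\<^sub>F x in nhds \<rho>. J_red k \<rho> (sol x) \<le> F \<rho>"
    by eventually_elim (use \<rho>(2) F_eq[OF \<rho>(2)] in \<open>auto simp: J_red_def is_max_def\<close>)
qed

subsection \<open>Multipliers\<close>

lemma has_derivative_h_pair:
  assumes "\<rho> \<in> P"
  shows "((\<lambda>(d, u). h \<rho> d) has_derivative (\<lambda>y. \<Sum>e\<in>UNIV. w e * a e \<rho> * fst y $ e)) (at z)"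
  unfolding case_prod_beta
  by (rule has_derivative_eq_rhs[OF has_derivative_h[OF has_derivative_const assms
        has_derivative_fst[OF has_derivative_ident]]]) simp

lemma has_derivative_J_pair:
  assumes "\<rho> \<in> P" "\<And>e. 0 \<le> \<delta>$e"
  shows "((\<lambda>(d, u). J \<rho> d u) has_derivative
     (\<lambda>y. (\<Sum>e\<in>UNIV. J_delta \<rho> \<delta> u e * fst y $ e) + J_u \<rho> \<delta> u \<bullet> snd y)) (at (\<delta>, u))"
proof -
  have "0 < compl (fst (\<delta>, u) $ e)" for e using compl_pos[OF assms(2)] by simp
  then show ?thesis
    unfolding case_prod_beta
    by (rule has_derivative_eq_rhs[OF has_derivative_J[OF has_derivative_const assms(1)
          has_derivative_fst[OF has_derivative_ident] _ has_derivative_snd[OF has_derivative_ident]]])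
      simp
qed

lemma KKT_iff:
  assumes \<rho>: "\<rho> \<in> P" and \<delta>: "\<And>e. 0 \<le> \<delta>$e"
  shows "KKT (\<lambda>(d, u). J \<rho> d u) (\<lambda>(d, u). h \<rho> d) (\<delta>, u) lm lp lam \<longleftrightarrow>
    (\<forall>e. 0 \<le> lm e \<and> 0 \<le> lp e \<and> lm e * \<delta>$e = 0 \<and> lp e * (\<delta>$e - 1) = 0) \<and>
    (\<forall>e. J_delta \<rho> \<delta> u e + lm e - lp e = lam * (w e * a e \<rho>)) \<and> J_u \<rho> \<delta> u = 0"
proof -
  let ?r = "\<lambda>e. J_delta \<rho> \<delta> u e + lm e - lp e - lam * (w e * a e \<rho>)"
  have "frechet_derivative (\<lambda>(d, u). J \<rho> d u) (at (\<delta>, u)) y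
      - (\<Sum>e\<in>UNIV. lm e * frechet_derivative (gminus e) (at (\<delta>, u)) y
         + lp e * frechet_derivative (gplus e) (at (\<delta>, u)) y)
      - lam * frechet_derivative (\<lambda>(d, u). h \<rho> d) (at (\<delta>, u)) y
    = (\<Sum>e\<in>UNIV. ?r e * fst y $ e) + J_u \<rho> \<delta> u \<bullet> snd y" for y
    unfolding frechet_derivative_bounds frechet_derivative_at[OF has_derivative_J_pair[OF \<rho> \<delta>], symmetric]
        frechet_derivative_at[OF has_derivative_h_pair[OF \<rho>], symmetric]
    by (simp add: sum.distrib sum_subtractf sum_distrib_left left_diff_distrib distrib_right sum_negf mult.assoc)
  moreover have "(\<forall>y. (\<Sum>e\<in>UNIV. ?r e * fst y $ e) + J_u \<rho> \<delta> u \<bullet> snd y = 0) \<longleftrightarrow>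
      (\<forall>e. ?r e = 0) \<and> J_u \<rho> \<delta> u = 0"
  proof (intro iffI conjI allI)
    assume st: "\<forall>y. (\<Sum>e\<in>UNIV. ?r e * fst y $ e) + J_u \<rho> \<delta> u \<bullet> snd y = 0"
    \<comment> \<open>Testing with \<open>J_u\<close> itself makes its squared norm vanish;
      coordinate vectors then isolate the rows in \<delta>.\<close>
    show "J_u \<rho> \<delta> u = 0" using spec[OF st, of "(0, J_u \<rho> \<delta> u)"] by simp
    fix k
    have "(\<Sum>e\<in>UNIV. g e * axis k 1 $ e) = g k" for g :: "'n \<Rightarrow> real"
      by (simp add: axis_def if_distrib[of "\<lambda>x. _ * x"] cong: if_cong)
    from this[of ?r] show "?r k = 0" using spec[OF st, of "(axis k 1, 0)"] by simp
  qed simp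
  ultimately show ?thesis
    unfolding KKT_def by (simp add: bound_apply)
qed

text \<open>If every component sat at a bound, the gradient of \<open>h\<close>, which has no
  \<open>u\<close>-part, would be a combination of the bound gradients with coefficients
  \<open>w e * a e \<rho>\<close> up to sign, against LICQ.\<close>

lemma LICQ_inactive:
  assumes \<rho>: "\<rho> \<in> P" and \<delta>: "\<And>e. 0 \<le> \<delta>$e \<and> \<delta>$e \<le> 1"
    and licq: "LICQ (\<lambda>(d, u). h \<rho> d) (\<delta>, u :: real^'m)"
  obtains k where "0 < \<delta>$k" "\<delta>$k < 1"
proof (rule ccontr)
  assume "\<not> thesis"
  then have active: "\<delta>$e = 0 \<or> \<delta>$e = 1" for e using that[of e] \<delta>[of e] by force
  have "(\<Sum>e\<in>UNIV. g e) = (\<Sum>e\<in>{e. \<delta>$e = 0}. g e) + (\<Sum>e\<in>{e. \<delta>$e = 1}. g e)" for g :: "'n \<Rightarrow> real"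
  proof -
    have "UNIV = {e. \<delta>$e = 0} \<union> {e. \<delta>$e = 1}" using active by auto
    then show ?thesis by (metis (mono_tags, lifting) disjoint_iff finite mem_Collect_eq sum.union_disjoint zero_neq_one)
  qed
  from this[of "\<lambda>e. w e * a e \<rho> * fst (y :: (real^'n) \<times> (real^'m)) $ e" for y]
  have "1 * frechet_derivative (\<lambda>(d, u). h \<rho> d) (at (\<delta>, u)) y
      + (\<Sum>e\<in>{e. gminus e (\<delta>, u) = 0}. (w e * a e \<rho>) * frechet_derivative (gminus e) (at (\<delta>, u)) y)
      + (\<Sum>e\<in>{e. gplus e (\<delta>, u) = 0}. (- (w e * a e \<rho>)) * frechet_derivative (gplus e) (at (\<delta>, u)) y) = 0" for y
    by (simp add: frechet_derivative_bounds bound_apply sum_negf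
        frechet_derivative_at[OF has_derivative_h_pair[OF \<rho>], symmetric])
  from licq[unfolded LICQ_def, rule_format, OF this] show False by simp
qed

text \<open>\<open>u\<close> is unconstrained, so a nonzero gradient would be a direction of
  ascent.\<close>

lemma is_max_J_u:
  assumes \<rho>: "\<rho> \<in> P" and max: "is_max \<rho> (\<delta>, u)"
  shows "J_u \<rho> \<delta> u = 0"
proof (rule ccontr)
  assume "J_u \<rho> \<delta> u \<noteq> 0"
  have \<delta>: "\<delta> \<in> feas \<rho>" and le: "\<And>v. J \<rho> \<delta> v \<le> J \<rho> \<delta> u" using max by (auto simp: is_max_def)
  then have c: "0 < compl (\<delta>$e)" for e by (auto simp: feas_def intro: compl_pos)
  have "((\<lambda>t. u + t *\<^sub>R J_u \<rho> \<delta> u) has_derivative (\<lambda>y. y *\<^sub>R J_u \<rho> \<delta> u)) (at 0)"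
    by (auto intro!: derivative_eq_intros)
  from has_derivative_J[OF has_derivative_const \<rho> has_derivative_const c this]
  have "((\<lambda>t. J \<rho> \<delta> (u + t *\<^sub>R J_u \<rho> \<delta> u)) has_real_derivative J_u \<rho> \<delta> u \<bullet> J_u \<rho> \<delta> u) (at 0)"
    by (simp add: has_field_derivative_def mult.commute[of _ "_ \<bullet> _"])
  from DERIV_pos_inc_right[OF this] obtain d where "d > 0"
    and "\<And>t. 0 < t \<Longrightarrow> t < d \<Longrightarrow> J \<rho> \<delta> u < J \<rho> \<delta> (u + t *\<^sub>R J_u \<rho> \<delta> u)"
    using \<open>J_u \<rho> \<delta> u \<noteq> 0\<close> by auto
  from this(2)[of "d / 2"] this(1) le[of "u + (d / 2) *\<^sub>R J_u \<rho> \<delta> u"] show False by simp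
qed

text \<open>Component \<open>e\<close> moves with speed \<open>s\<close> and component
  \<open>k\<close> compensates. The left side is the resulting derivative of \<open>J\<close>. Only
  \<open>e\<close> needs an admissibility assumption, because \<open>k\<close> has slack on both
  sides.\<close>

lemma is_max_no_ascent:
  assumes \<rho>: "\<rho> \<in> P" and max: "is_max \<rho> (\<delta>, u)" and k: "0 < \<delta>$k" "\<delta>$k < 1" and "e \<noteq> k"
    and adm: "\<forall>\<^sub>F t in at_right 0. 0 \<le> \<delta>$e + t * s \<and> \<delta>$e + t * s \<le> 1"
  shows "s * (J_delta \<rho> \<delta> u e - J_delta \<rho> \<delta> u k / (w k * a k \<rho>) * (w e * a e \<rho>)) \<le> 0"
proof (rule ccontr)
  assume pos: "\<not> ?thesis"
  have \<delta>: "\<delta> \<in> feas \<rho>" and le: "\<And>\<eta>. \<eta> \<in> feas \<rho> \<Longrightarrow> J \<rho> \<eta> u \<le> J \<rho> \<delta> u"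
    using max by (auto simp: is_max_def)
  have wa: "0 < w k * a k \<rho>" using w_pos a_pos[OF \<rho>] by simp
  \<comment> \<open>The exchange rate that keeps \<open>h\<close> exactly constant along the
    segment, as \<open>h\<close> is affine in \<delta>.\<close>
  define c where "c = w e * a e \<rho> / (w k * a k \<rho>)"
  define g where "g t = \<delta> + (t * s) *\<^sub>R (axis e 1 - c *\<^sub>R axis k 1)" for t
  have g_nth: "g t $ i = (if i = e then \<delta>$e + t * s else if i = k then \<delta>$k - t * s * c else \<delta>$i)" for t i
    using \<open>e \<noteq> k\<close> by (simp add: g_def axis_def)
  have pick: "(\<Sum>i\<in>UNIV. b i * ((y * s) *\<^sub>R (axis e 1 - c *\<^sub>R axis k 1)) $ i) = y * s * (b e - c * b k)"
    for b :: "'n \<Rightarrow> real" and y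
  proof -
    have "(\<Sum>i\<in>UNIV. b i * ((y * s) *\<^sub>R (axis e 1 - c *\<^sub>R axis k 1)) $ i)
        = (\<Sum>i\<in>UNIV. (if i = e then y * s * b e else 0) - (if i = k then y * s * c * b k else 0))"
      using \<open>e \<noteq> k\<close> by (intro sum.cong) (auto simp: axis_def)
    then show ?thesis by (simp add: sum_subtractf algebra_simps)
  qed
  have "(\<Sum>i\<in>UNIV. w i * a i \<rho> * g t $ i) = (\<Sum>i\<in>UNIV. w i * a i \<rho> * \<delta> $ i)
      + t * s * (w e * a e \<rho> - c * (w k * a k \<rho>))" for t
    unfolding pick[of "\<lambda>i. w i * a i \<rho>", symmetric] g_def
    by (simp only: vector_add_component distrib_left sum.distrib)
  moreover have "c * (w k * a k \<rho>) = w e * a e \<rho>"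
    using wa unfolding c_def by (intro nonzero_eq_divide_eq[THEN iffD1]) auto
  ultimately have h_g: "h \<rho> (g t) = h \<rho> \<delta>" for t by (simp add: h_def)
  have "(g has_derivative (\<lambda>y. (y * s) *\<^sub>R (axis e 1 - c *\<^sub>R axis k 1))) (at 0)"
    unfolding g_def by (auto intro!: derivative_eq_intros)
  moreover have "0 < compl (g 0 $ i)" for i using \<delta> by (auto simp: feas_def g_def intro: compl_pos)
  ultimately have "((\<lambda>t. J \<rho> (g t) u) has_derivative (\<lambda>y. J_rho \<rho> (g 0) u \<bullet> 0
      + (\<Sum>i\<in>UNIV. J_delta \<rho> (g 0) u i * ((y * s) *\<^sub>R (axis e 1 - c *\<^sub>R axis k 1)) $ i)
      + J_u \<rho> (g 0) u \<bullet> 0)) (at 0)"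
    by (intro has_derivative_J has_derivative_const \<rho>)
  then have "((\<lambda>t. J \<rho> (g t) u) has_real_derivative s * (J_delta \<rho> \<delta> u e - c * J_delta \<rho> \<delta> u k)) (at 0)"
    unfolding pick has_field_derivative_def
    by (rule has_derivative_eq_rhs) (auto simp: g_def)
  from DERIV_pos_inc_right[OF this] pos
  obtain d where d: "d > 0" "\<And>t. 0 < t \<Longrightarrow> t < d \<Longrightarrow> J \<rho> (g 0) u < J \<rho> (g t) u"
    by (auto simp: c_def mult.commute)
  have "((\<lambda>t. \<delta>$k - t * s * c) \<longlongrightarrow> \<delta>$k - 0 * s * c) (at_right 0)"
    by (intro tendsto_intros)
  then have "\<forall>\<^sub>F t in at_right 0. 0 < \<delta>$k - t * s * c" "\<forall>\<^sub>F t in at_right 0. \<delta>$k - t * s * c < 1"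
    using k by (auto dest: order_tendstoD)
  moreover have "\<forall>\<^sub>F t in at_right 0. t \<in> {0<..<d}"
    using d(1) by (rule eventually_at_right_real)
  ultimately have "\<forall>\<^sub>F t in at_right (0::real). False"
    using adm
  proof eventually_elim
    case (elim t)
    then have "g t \<in> feas \<rho>" using \<delta> h_g by (auto simp: feas_def g_nth)
    with le[of "g t"] d(2)[of t] elim show False by (auto simp: g_def)
  qed
  then show False by simp
qed

text \<open>The bound multipliers are the positive and negative parts of the reduced gradient
  \<open>r\<close>. Its sign is known wherever \<open>e\<close> can move up or down, and this is
  complementarity.\<close>

lemma KKT_exists:
  assumes \<rho>: "\<rho> \<in> P" and max: "is_max \<rho> (\<delta>, u)" and k: "0 < \<delta>$k" "\<delta>$k < 1"
  shows "\<exists>lm lp. KKT (\<lambda>(d, u). J \<rho> d u) (\<lambda>(d, u). h \<rho> d) (\<delta>, u) lm lp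
           (J_delta \<rho> \<delta> u k / (w k * a k \<rho>))"
proof -
  have \<delta>: "0 \<le> \<delta>$e" "\<delta>$e \<le> 1" for e using max by (auto simp: is_max_def feas_def)
  define r where "r e = J_delta \<rho> \<delta> u e - J_delta \<rho> \<delta> u k / (w k * a k \<rho>) * (w e * a e \<rho>)" for e
  have rk: "r k = 0" using w_pos[of k] a_pos[OF \<rho>, of k] by (simp add: r_def)
  have "r e \<le> 0" if "\<delta>$e < 1" for e
  proof (cases "e = k")
    case False
    have "((\<lambda>t. \<delta>$e + t * 1) \<longlongrightarrow> \<delta>$e + 0 * 1) (at_right 0)" by (intro tendsto_intros)
    then have "\<forall>\<^sub>F t in at_right 0. \<delta>$e + t * 1 < 1" using that by (auto dest: order_tendstoD)
    moreover have "\<forall>\<^sub>F t in at_right 0. t \<in> {0<..<1::real}" by (rule eventually_at_right_real) simp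
    ultimately have "\<forall>\<^sub>F t in at_right 0. 0 \<le> \<delta>$e + t * 1 \<and> \<delta>$e + t * 1 \<le> 1"
      by eventually_elim (use \<delta>[of e] in auto)
    from is_max_no_ascent[OF \<rho> max k False this] show ?thesis by (simp add: r_def)
  qed (simp add: rk)
  moreover have "0 \<le> r e" if "0 < \<delta>$e" for e
  proof (cases "e = k")
    case False
    have "((\<lambda>t. \<delta>$e + t * - 1) \<longlongrightarrow> \<delta>$e + 0 * - 1) (at_right 0)" by (intro tendsto_intros)
    then have "\<forall>\<^sub>F t in at_right 0. 0 < \<delta>$e + t * - 1" using that by (auto dest: order_tendstoD)
    moreover have "\<forall>\<^sub>F t in at_right 0. t \<in> {0<..<1::real}" by (rule eventually_at_right_real) simp
    ultimately have "\<forall>\<^sub>F t in at_right 0. 0 \<le> \<delta>$e + t * - 1 \<and> \<delta>$e + t * - 1 \<le> 1"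
      by eventually_elim (use \<delta>[of e] in auto)
    from is_max_no_ascent[OF \<rho> max k False this] show ?thesis by (simp add: r_def)
  qed (simp add: rk)
  ultimately have "max 0 (- r e) * \<delta>$e = 0" "max 0 (r e) * (\<delta>$e - 1) = 0" for e
    using \<delta>[of e] by (auto simp: max_def) (metis less_eq_real_def order_antisym)+
  moreover have "J_delta \<rho> \<delta> u e + max 0 (- r e) - max 0 (r e)
      = J_delta \<rho> \<delta> u k / (w k * a k \<rho>) * (w e * a e \<rho>)" for e
    by (auto simp: r_def max_def)
  ultimately show ?thesis
    using is_max_J_u[OF \<rho> max]
    by (intro exI[of _ "\<lambda>e. max 0 (- r e)"] exI[of _ "\<lambda>e. max 0 (r e)"])
      (subst KKT_iff[OF \<rho> \<delta>(1)], simp)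
qed

text \<open>Complementarity removes both bound multipliers at \<open>k\<close>, and row
  \<open>k\<close> of stationarity determines \<open>lam\<close>.\<close>

lemma KKT_multiplier_eq:
  assumes \<rho>: "\<rho> \<in> P" and \<delta>: "\<And>e. 0 \<le> \<delta>$e" and k: "0 < \<delta>$k" "\<delta>$k < 1"
    and kkt: "KKT (\<lambda>(d, u). J \<rho> d u) (\<lambda>(d, u). h \<rho> d) (\<delta>, u) lm lp lam"
  shows "lam = J_delta \<rho> \<delta> u k / (w k * a k \<rho>)"
proof -
  have "lm k * \<delta>$k = 0" "lp k * (\<delta>$k - 1) = 0"
    and st: "J_delta \<rho> \<delta> u k + lm k - lp k = lam * (w k * a k \<rho>)"
    using kkt unfolding KKT_iff[OF \<rho> \<delta>] by auto
  then have "lm k = 0" "lp k = 0" using k by auto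
  then show ?thesis using st w_pos[of k] a_pos[OF \<rho>, of k] by (simp add: field_simps)
qed

lemma sensitivity:
  assumes \<rho>: "\<rho> \<in> P" and max: "is_max \<rho> (\<delta>, u)"
    and licq: "LICQ (\<lambda>(d, u). h \<rho> d) (\<delta>, u)"
  shows "\<exists>G S. open S \<and> \<rho> \<in> S \<and> (\<forall>x\<in>S. (F has_derivative (\<lambda>v. G x \<bullet> v)) (at x)) \<and> isCont G \<rho> \<and>
    (\<exists>!lam. \<exists>lm lp. KKT (\<lambda>(d, u). J \<rho> d u) (\<lambda>(d, u). h \<rho> d) (\<delta>, u) lm lp lam) \<and>
    (\<forall>lm lp lam. KKT (\<lambda>(d, u). J \<rho> d u) (\<lambda>(d, u). h \<rho> d) (\<delta>, u) lm lp lam \<longrightarrow>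
       G \<rho> = J_rho \<rho> \<delta> u - lam *\<^sub>R h_rho \<rho> \<delta>)"
proof -
  have \<delta>: "\<And>e. 0 \<le> \<delta>$e \<and> \<delta>$e \<le> 1" "\<delta> \<in> feas \<rho>" using max by (auto simp: is_max_def feas_def)
  obtain k where k: "0 < \<delta>$k" "\<delta>$k < 1" using LICQ_inactive[OF \<rho> \<delta>(1) licq] by blast
  have sol: "sol \<rho> = (\<delta>, u)" using sol_eq[OF \<rho> max] .
  have int: "\<rho> \<in> interior_sol k" using \<rho> \<delta> k by (auto simp: interior_sol_def sol)
  define G where "G x = grad_red k x (sol x)" for x
  show ?thesis
  proof (intro exI[of _ G] exI[of _ "interior_sol k"] conjI ballI allI impI)
    show "open (interior_sol k)" "\<rho> \<in> interior_sol k" using open_interior_sol int by auto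
    show "(F has_derivative (\<lambda>v. G x \<bullet> v)) (at x)" if "x \<in> interior_sol k" for x
      unfolding G_def by (rule F_has_derivative[OF that])
    have "(G \<longlongrightarrow> G \<rho>) (nhds \<rho>)"
      unfolding G_def
      by (intro tendsto_intros tendsto_sol[OF int] \<rho> filterlim_ident)
        (use \<delta> in \<open>auto simp: sol shift_feas intro: compl_pos\<close>)
    then show "isCont G \<rho>" by (simp add: isCont_def tendsto_at_iff_tendsto_nhds)
    show "\<exists>!lam. \<exists>lm lp. KKT (\<lambda>(d, u). J \<rho> d u) (\<lambda>(d, u). h \<rho> d) (\<delta>, u) lm lp lam"
      using KKT_exists[OF \<rho> max k] KKT_multiplier_eq[OF \<rho> _ k] \<delta>(1) by blast
    fix lm lp lam assume "KKT (\<lambda>(d, u). J \<rho> d u) (\<lambda>(d, u). h \<rho> d) (\<delta>, u) lm lp lam"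
    then have "lam = J_delta \<rho> \<delta> u k / (w k * a k \<rho>)"
      using KKT_multiplier_eq[OF \<rho> _ k] \<delta>(1) by blast
    \<comment> \<open>Removes the \<open>a' k\<close> term from \<open>grad_red\<close>, leaving the
      multiplier formula.\<close>
    moreover have "h \<rho> \<delta> = 0" using \<delta>(2) by (simp add: feas_def)
    ultimately show "G \<rho> = J_rho \<rho> \<delta> u - lam *\<^sub>R h_rho \<rho> \<delta>"
      by (simp add: G_def grad_red_def sol shift_feas[OF \<delta>(2)])
  qed
qed

end

subsection \<open>The filtered compliance problem\<close>

lemma quad_Kel:
  "u \<bullet> (Kel Vs Fw p E0 ED Khat \<rho> \<delta> e *v u)
     = filt Vs Fw \<rho> e powr p * Emod E0 ED (\<delta>$e) * (u \<bullet> (Khat e *v u))"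
  unfolding Kel_def scaleR_matrix_vector_assoc[symmetric] inner_scaleR_right ..

lemma sum_matrix_vector_mult:
  fixes M :: "'i \<Rightarrow> real^'n^'m"
  shows "(\<Sum>i\<in>I. M i) *v u = (\<Sum>i\<in>I. M i *v u)"
  by (induction I rule: infinite_finite_induct) (auto simp: matrix_vector_mult_add_rdistrib)

lemma quad_Kglob:
  "u \<bullet> (Kglob Vs Fw p E0 ED Khat \<rho> \<delta> *v u)
     = (\<Sum>e\<in>UNIV. filt Vs Fw \<rho> e powr p * Emod E0 ED (\<delta>$e) * (u \<bullet> (Khat e *v u)))"
  unfolding Kglob_def sum_matrix_vector_mult inner_sum_right quad_Kel ..

lemma filt_pos:
  fixes \<rho> :: "real^'n::finite"
  assumes "Vs e \<noteq> {}" "\<And>j. j \<in> Vs e \<Longrightarrow> Fw e j > 0" "\<And>j. 0 < \<rho>$j"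
  shows "0 < filt Vs Fw \<rho> e"
  unfolding filt_def using assms by (intro divide_pos_pos sum_pos mult_pos_pos) auto

text \<open>A row of the normalized filter matrix, which is the constant gradient of the filtered
  density.\<close>

definition filt_vec :: "('n \<Rightarrow> 'n set) \<Rightarrow> ('n \<Rightarrow> 'n \<Rightarrow> real) \<Rightarrow> 'n::finite \<Rightarrow> real^'n" where
  "filt_vec Vs Fw e = (\<chi> j. if j \<in> Vs e then Fw e j / (\<Sum>j\<in>Vs e. Fw e j) else 0)"

lemma filt_eq_inner: "filt Vs Fw \<rho> e = filt_vec Vs Fw e \<bullet> \<rho>"
proof -
  have "filt_vec Vs Fw e \<bullet> \<rho> = (\<Sum>j\<in>UNIV. if j \<in> Vs e then Fw e j * \<rho>$j / (\<Sum>j\<in>Vs e. Fw e j) else 0)"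
    unfolding inner_vec_def by (intro sum.cong) (auto simp: filt_vec_def)
  also have "\<dots> = (\<Sum>j\<in>Vs e. Fw e j * \<rho>$j / (\<Sum>j\<in>Vs e. Fw e j))"
    by (simp add: sum.If_cases)
  finally show ?thesis by (simp add: filt_def sum_divide_distrib)
qed

definition filt_powr_grad :: "('n \<Rightarrow> 'n set) \<Rightarrow> ('n \<Rightarrow> 'n \<Rightarrow> real) \<Rightarrow> real \<Rightarrow> 'n::finite \<Rightarrow> real^'n \<Rightarrow> real^'n"
  where "filt_powr_grad Vs Fw p e \<rho> = (p * filt Vs Fw \<rho> e powr (p - 1)) *\<^sub>R filt_vec Vs Fw e"

lemma filt_powr_has_derivative:
  assumes "0 < filt Vs Fw \<rho> e"
  shows "((\<lambda>\<rho>. filt Vs Fw \<rho> e powr p) has_derivative (\<lambda>v. filt_powr_grad Vs Fw p e \<rho> \<bullet> v)) (at \<rho>)"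
proof -
  have lin: "((\<lambda>\<rho>. filt Vs Fw \<rho> e) has_derivative (\<lambda>v. filt_vec Vs Fw e \<bullet> v)) (at \<rho>)"
    unfolding filt_eq_inner by (intro has_derivative_inner_right has_derivative_ident)
  have "((\<lambda>x. x powr p) has_derivative (\<lambda>y. p * filt Vs Fw \<rho> e powr (p - 1) * y)) (at (filt Vs Fw \<rho> e))"
    using has_real_derivative_powr[OF assms, of p] by (simp add: has_field_derivative_def)
  from has_derivative_compose[OF lin this] show ?thesis
    by (simp add: filt_powr_grad_def)
qed

theorem theorem4:
  fixes Vs :: "'n::finite \<Rightarrow> 'n set" and Fw :: "'n \<Rightarrow> 'n \<Rightarrow> real"
    and p E0 ED \<epsilon> rhomin Vf D :: real
    and vol :: "'n \<Rightarrow> real"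
    and Khat :: "'n \<Rightarrow> real^'m::finite^'m" and f :: "real^'m"
    and \<rho>b \<delta>b :: "real^'n" and ub :: "real^'m"
  assumes p: "p > 1"
    and E: "E0 > ED" "ED > 0"
    and eps: "\<epsilon> > 0"
    and rmin: "0 < rhomin" "rhomin < 1"
    and Vf: "Vf > 0" and D: "D > 0"
    and vol: "\<And>e. vol e > 0"
    and Vs: "\<And>e. Vs e \<noteq> {}"
    and Fw: "\<And>e j. j \<in> Vs e \<Longrightarrow> Fw e j > 0"
    and Khat: "\<And>e. sym_psd (Khat e)"
    and Kpd: "\<And>\<rho> \<delta>. \<rho> \<in> Uad rhomin vol Vf \<Longrightarrow> (\<forall>e. 0 \<le> \<delta>$e \<and> \<delta>$e \<le> 1) \<Longrightarrow>
                  pos_def (Kglob Vs Fw p E0 ED Khat \<rho> \<delta>)"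
    and \<rho>b: "\<rho>b \<in> Uad rhomin vol Vf"
    and \<delta>b: "\<delta>b \<in> Dad Vs Fw p vol D \<rho>b"
    and maxim: "\<And>\<delta> u. \<delta> \<in> Dad Vs Fw p vol D \<rho>b \<Longrightarrow>
                  Jeps Vs Fw p E0 ED Khat f \<epsilon> \<rho>b \<delta> u \<le> Jeps Vs Fw p E0 ED Khat f \<epsilon> \<rho>b \<delta>b ub"
    and uniq: "\<And>\<delta> u. \<delta> \<in> Dad Vs Fw p vol D \<rho>b \<Longrightarrow>
                  Jeps Vs Fw p E0 ED Khat f \<epsilon> \<rho>b \<delta> u = Jeps Vs Fw p E0 ED Khat f \<epsilon> \<rho>b \<delta>b ub \<Longrightarrow>
                  \<delta> = \<delta>b \<and> u = ub"
    and licq: "LICQ (\<lambda>(d, u). hcon Vs Fw p vol D \<rho>b d) (\<delta>b, ub)"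
  shows "\<exists>G S. open S \<and> \<rho>b \<in> S \<and>
           (\<forall>\<rho>\<in>S. (Feps Vs Fw p E0 ED Khat f \<epsilon> vol D has_derivative (\<lambda>v. G \<rho> \<bullet> v)) (at \<rho>)) \<and>
           continuous (at \<rho>b) G \<and>
           (\<exists>!lam. \<exists>lm lp. KKT (\<lambda>(d, u). Jeps Vs Fw p E0 ED Khat f \<epsilon> \<rho>b d u)
                                (\<lambda>(d, u). hcon Vs Fw p vol D \<rho>b d) (\<delta>b, ub) lm lp lam) \<and>
           (\<forall>lm lp lam. KKT (\<lambda>(d, u). Jeps Vs Fw p E0 ED Khat f \<epsilon> \<rho>b d u)
                             (\<lambda>(d, u). hcon Vs Fw p vol D \<rho>b d) (\<delta>b, ub) lm lp lam \<longrightarrow>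
              (\<forall>e. G \<rho>b $ e =
                   - (ub \<bullet> (frechet_derivative (\<lambda>\<rho>. Kglob Vs Fw p E0 ED Khat \<rho> \<delta>b) (at \<rho>b) (axis e 1)
                             *v ub))
                   - lam * frechet_derivative (\<lambda>\<rho>. hcon Vs Fw p vol D \<rho> \<delta>b) (at \<rho>b) (axis e 1)))"
proof -
  \<comment> \<open>Positivity of the filtered densities is an open condition under which the power
    is smooth. It holds at \<open>\<rho>b\<close>, whose entries are at least
    \<open>rhomin > 0\<close>.\<close>
  define P where "P = {\<rho>. \<forall>e. 0 < filt Vs Fw \<rho> e}"
  define W where "W = (\<Sum>e\<in>UNIV. vol e)"
  have W: "0 < W" unfolding W_def using vol by (intro sum_pos) auto
  have cont_filt: "continuous_on A (\<lambda>\<rho>. filt Vs Fw \<rho> e)" for A e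
    unfolding filt_eq_inner by (intro continuous_intros)
  have "0 < \<rho>b$j" for j using \<rho>b rmin by (auto simp: Uad_def intro: less_le_trans)
  then have \<rho>bP: "\<rho>b \<in> P" unfolding P_def using Vs Fw by (auto intro: filt_pos)
  have filt_nz: "filt Vs Fw \<rho> e \<noteq> 0" if "\<rho> \<in> P" for \<rho> e
    using that unfolding P_def by (metis mem_Collect_eq less_irrefl)
  interpret pc: parametric_compliance "\<lambda>e \<rho>. filt Vs Fw \<rho> e powr p" "filt_powr_grad Vs Fw p" P
    "\<lambda>e. vol e / W" E0 ED \<epsilon> D Khat f
  proof
    show "open P" unfolding P_def Collect_all_eq
      by (intro open_INT ballI open_Collect_less continuous_on_const cont_filt) simp
    show "0 < filt Vs Fw \<rho> e powr p" if "\<rho> \<in> P" for \<rho> e using that by (simp add: filt_nz)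
    show "((\<lambda>\<rho>. filt Vs Fw \<rho> e powr p) has_derivative (\<lambda>v. filt_powr_grad Vs Fw p e \<rho> \<bullet> v)) (at \<rho>)"
      if "\<rho> \<in> P" for \<rho> e using that by (intro filt_powr_has_derivative) (auto simp: P_def)
    show "continuous_on P (filt_powr_grad Vs Fw p e)" for e
      unfolding filt_powr_grad_def[abs_def] by (intro continuous_intros cont_filt) (simp add: filt_nz)
    show "0 < vol e / W" for e using vol W by simp
    fix u :: "real^'m" assume u: "u \<noteq> 0"
    \<comment> \<open>The design \<open>\<delta> = 0\<close> lies in the box, so definiteness is
      available there. A positive weighted sum has a nonzero summand, and semidefiniteness makes
      that form positive without its weight.\<close>
    have "pos_def (Kglob Vs Fw p E0 ED Khat \<rho>b 0)" by (rule Kpd[OF \<rho>b]) simp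
    with u have "0 < (\<Sum>e\<in>UNIV. filt Vs Fw \<rho>b e powr p * Emod E0 ED ((0::real^'n)$e) * (u \<bullet> (Khat e *v u)))"
      unfolding pos_def_def quad_Kglob by blast
    from less_imp_neq[OF this, symmetric]
    obtain e where "filt Vs Fw \<rho>b e powr p * Emod E0 ED ((0::real^'n)$e) * (u \<bullet> (Khat e *v u)) \<noteq> 0"
      by (rule sum.not_neutral_contains_not_neutral)
    then have "u \<bullet> (Khat e *v u) \<noteq> 0" by auto
    then have "0 < u \<bullet> (Khat e *v u)"
      using Khat[of e] unfolding sym_psd_def by (metis order_le_less)
    then show "0 < (\<Sum>e\<in>UNIV. u \<bullet> (Khat e *v u))"
      using Khat by (intro sum_pos2[of _ e]) (auto simp: sym_psd_def)
  qed (use E eps Khat in auto)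
  have J: "Jeps Vs Fw p E0 ED Khat f \<epsilon> = pc.J"
    by (intro ext) (simp add: Jeps_def pc.J_def quad_Kel)
  have h: "hcon Vs Fw p vol D = pc.h"
    by (intro ext) (simp add: hcon_def pc.h_def W_def[symmetric] sum_divide_distrib)
  have feas: "Dad Vs Fw p vol D = pc.feas"
    by (intro ext) (simp add: Dad_def pc.feas_def h)
  have F: "Feps Vs Fw p E0 ED Khat f \<epsilon> vol D = pc.F"
    by (intro ext) (simp add: Feps_def pc.F_def J feas)
  have max: "pc.is_max \<rho>b (\<delta>b, ub)"
    using \<delta>b maxim by (simp add: pc.is_max_def J feas)
  obtain G S where GS: "open S" "\<rho>b \<in> S" "\<forall>\<rho>\<in>S. (pc.F has_derivative (\<lambda>v. G \<rho> \<bullet> v)) (at \<rho>)"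
      "isCont G \<rho>b" "\<exists>!lam. \<exists>lm lp. KKT (\<lambda>(d, u). pc.J \<rho>b d u) (\<lambda>(d, u). pc.h \<rho>b d) (\<delta>b, ub) lm lp lam"
    and grad: "\<And>lm lp lam. KKT (\<lambda>(d, u). pc.J \<rho>b d u) (\<lambda>(d, u). pc.h \<rho>b d) (\<delta>b, ub) lm lp lam \<Longrightarrow>
       G \<rho>b = pc.J_rho \<rho>b \<delta>b ub - lam *\<^sub>R pc.h_rho \<rho>b \<delta>b"
    using pc.sensitivity[OF \<rho>bP max licq[unfolded h]] by blast
  have dh: "frechet_derivative (\<lambda>\<rho>. hcon Vs Fw p vol D \<rho> \<delta>b) (at \<rho>b) = (\<lambda>v. pc.h_rho \<rho>b \<delta>b \<bullet> v)"
    unfolding h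
    by (rule frechet_derivative_at[symmetric], rule has_derivative_eq_rhs[OF
          pc.has_derivative_h[OF has_derivative_ident \<rho>bP has_derivative_const]]) simp
  have "((\<lambda>\<rho>. Kglob Vs Fw p E0 ED Khat \<rho> \<delta>b) has_derivative
      (\<lambda>v. \<Sum>e\<in>UNIV. ((filt_powr_grad Vs Fw p e \<rho>b \<bullet> v) * Emod E0 ED (\<delta>b$e)) *\<^sub>R Khat e)) (at \<rho>b)"
    unfolding Kglob_def Kel_def
    by (intro has_derivative_sum has_derivative_scaleR_left has_derivative_mult_left pc.a_deriv \<rho>bP)
  then have dK: "frechet_derivative (\<lambda>\<rho>. Kglob Vs Fw p E0 ED Khat \<rho> \<delta>b) (at \<rho>b) =
      (\<lambda>v. \<Sum>e\<in>UNIV. ((filt_powr_grad Vs Fw p e \<rho>b \<bullet> v) * Emod E0 ED (\<delta>b$e)) *\<^sub>R Khat e)"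
    by (rule frechet_derivative_at[symmetric])
  \<comment> \<open>Contracting the matrix derivative with \<open>ub\<close> on both sides gives the
    \<rho>-gradient of the objective, with the derivative of the filter inside
    \<open>filt_powr_grad\<close>.\<close>
  have quad_dK: "- (ub \<bullet> (frechet_derivative (\<lambda>\<rho>. Kglob Vs Fw p E0 ED Khat \<rho> \<delta>b) (at \<rho>b) v *v ub))
      = pc.J_rho \<rho>b \<delta>b ub \<bullet> v" for v
    unfolding dK sum_matrix_vector_mult inner_sum_right scaleR_matrix_vector_assoc[symmetric]
      inner_scaleR_right pc.J_rho_def inner_minus_left inner_sum_left inner_scaleR_left
    by (simp add: mult_ac)
  show ?thesis
  proof (intro exI[of _ G] exI[of _ S] conjI allI impI)
    show "open S" "\<rho>b \<in> S" "continuous (at \<rho>b) G" by fact+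
    show "\<forall>\<rho>\<in>S. (Feps Vs Fw p E0 ED Khat f \<epsilon> vol D has_derivative (\<lambda>v. G \<rho> \<bullet> v)) (at \<rho>)"
      unfolding F by fact
    show "\<exists>!lam. \<exists>lm lp. KKT (\<lambda>(d, u). Jeps Vs Fw p E0 ED Khat f \<epsilon> \<rho>b d u)
        (\<lambda>(d, u). hcon Vs Fw p vol D \<rho>b d) (\<delta>b, ub) lm lp lam"
      unfolding J h by fact
    fix lm lp lam e
    assume "KKT (\<lambda>(d, u). Jeps Vs Fw p E0 ED Khat f \<epsilon> \<rho>b d u)
        (\<lambda>(d, u). hcon Vs Fw p vol D \<rho>b d) (\<delta>b, ub) lm lp lam"
    then have "G \<rho>b = pc.J_rho \<rho>b \<delta>b ub - lam *\<^sub>R pc.h_rho \<rho>b \<delta>b"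
      unfolding J h by (rule grad)
    then show "G \<rho>b $ e =
        - (ub \<bullet> (frechet_derivative (\<lambda>\<rho>. Kglob Vs Fw p E0 ED Khat \<rho> \<delta>b) (at \<rho>b) (axis e 1) *v ub))
        - lam * frechet_derivative (\<lambda>\<rho>. hcon Vs Fw p vol D \<rho> \<delta>b) (at \<rho>b) (axis e 1)"
      unfolding quad_dK dh by (simp add: inner_axis)
  qed
qed

end
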